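(* Each of the three sets of orders $N_1,N_2,N_3$ (of the Singer-cycle, ternary-binomial and completed-reciprocal constructions of APN permutations, defined in the context) contains infinitely many composite integers $n$ that are not of any of the forms $r-1,r-2,r-3,r-4$ with $r$ a prime power. Moreover, each of $N_2$ and $N_3$ contains infinitely many integers not of the form $r+1$ with $r$ a prime power, while the set $\{q+1: q \text{ prime},\ q\equiv 269363\pmod{471240}\}\subseteq N_1$ contains no integer of the form $2p$ with $p$ prime.
   Context: $\mathbb Z_n=\mathbb Z/n\mathbb Z$. A map $F:\mathbb Z_n\to\mathbb Z_n$ is APN if $\max_{u\neq 0,\,v}\#\{x: F(x+u)-F(x)=v\}=2$. The order of a permutation of $\mathbb Z_n$ is $n$. $N_1$ (Singer-cycle construction): the set of $n=q+1$, $q$ an odd prime power. The APN permutations of $\mathbb Z_{q+1}$ are the maps $F_M$ with $F_M(i)=j$ iff $M(R^iP_0)=R^jP_0$, where $R$ generates a cyclic subgroup of order $q+1$ of $\mathrm{PGL}_2(q)$ (acting regularly on $\mathbb P^1(\mathbb F_q)$), $P_0\in\mathbb P^1(\mathbb F_q)$, and $M\in\mathrm{PGL}_2(q)$ does not commute with $J=R^{(q+1)/2}$. $N_2$ (ternary-binomial construction): the set of $n=(3^d-1)/2$, $d\ge 2$. The APN permutations of $\mathbb Z_n$ are the maps $F_{k,c,s}$, where $F_{k,c,s}(i)$ is the unique $j$ with $(\alpha^i)^{k3^s}+c(\alpha^i)^k\in\{\alpha^j,-\alpha^j\}$, with $\alpha$ primitive in $\mathbb F_{3^d}$, $s\ge1$,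 $\gcd(s,d)=1$, $k\ge1$, $\gcd(k,n)=1$, $c\in\mathbb F_{3^d}^*$ and $-c$ a nonsquare. $N_3$ (completed-reciprocal construction): the set of $n=2p$, $p>5$ prime with $p\equiv5\pmod 6$. The APN permutations of $\mathbb Z_{2p}$ are the maps $\mathcal B_{a,c,p}(z)\equiv pR(z)+(p+1)Y(z)\pmod{2p}$, where $c\in\mathbb F_p$, $a\in\mathbb F_p^*$ with $\chi(a)=\chi(1-4a)=\chi(1-4/a)=-1$ ($\chi$ the quadratic character of $\mathbb F_p$), $E(z)\in\{0,1\}$ is the parity of $z$, $X(z)=z+cE(z)\in\mathbb F_p$, $Y(z)=(1+(a-1)E(z))X(z)^{p-2}\in\mathbb F_p$, $R(z)\in\{0,1\}$ with $R(z)\equiv\rho(X(z))+E(z)(1-\chi(X(z))^2)\pmod 2$, and $\rho$ is the indicator function of the nonzero squares of $\mathbb F_p$. *)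

theory Defs
  imports "HOL-Number_Theory.Number_Theory" "HOL-Number_Theory.Prime_Powers"
begin

definition singer_orders :: "nat set" where
  "singer_orders = {q + 1 | q. primepow q \<and> odd q}"

definition ternary_binomial_orders :: "nat set" where
  "ternary_binomial_orders = {(3 ^ d - 1) div 2 | d. d \<ge> 2}"

definition completed_reciprocal_orders :: "nat set" where
  "completed_reciprocal_orders = {2 * p | p. prime p \<and> p > 5 \<and> [p = 5] (mod 6)}"

definition composite :: "nat \<Rightarrow> bool" where
  "composite n \<longleftrightarrow> n > 1 \<and> \<not> prime n"

text \<open>The subtraction takes place in the integers, since on the naturals it would truncate.\<close>

definition primepow_minus_1_to_4 :: "nat \<Rightarrow> bool" where
  "primepow_minus_1_to_4 n \<longleftrightarrow>
     (\<exists>r::nat. primepow r \<and> int n \<in> {int r - 1, int r - 2, int r - 3, int r - 4})"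

definition primepow_plus_1 :: "nat \<Rightarrow> bool" where
  "primepow_plus_1 n \<longleftrightarrow> (\<exists>r::nat. primepow r \<and> n = r + 1)"

end

theory Submission
  imports Defs "HOL-Computational_Algebra.Squarefree"
begin

text \<open>
  A number exactly divisible by a prime \<open>p\<close> (divisible by \<open>p\<close> but not by \<open>p\<^sup>2\<close>) and different from \<open>p\<close>
  is not a prime power, and neither is a number with two different prime factors. Each infinite
  family below therefore fixes enough of \<open>n\<close> modulo small primes to make \<open>n + 1\<close>, \<dots>, \<open>n + 4\<close> (and
  \<open>n - 1\<close>) fail to be prime powers for such a reason.

  For the first two families the residues are controlled by an exponent: the powers of \<open>3\<close> are
  periodic modulo every number prime to \<open>3\<close>. The orders \<open>q + 1\<close> with \<open>q = 3 ^ (2 + 390 * j)\<close> imitate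
  \<open>q = 9\<close>, where \<open>q + 2 = 11\<close>, \<open>q + 3 = 12\<close>, \<open>q + 4 = 13\<close>, \<open>q + 5 = 14\<close>; the orders
  \<open>(3 ^ d - 1) / 2\<close> with \<open>d = 9 + 660 * j\<close> imitate \<open>d = 9\<close>, where \<open>n = 9841 = 13 * 757\<close>.

  For \<open>n = 2 * p\<close> the prime \<open>p\<close> itself has to lie in a residue class. The numbers \<open>2p - 1\<close>, \<open>2p + 1\<close>,
  \<open>2p + 3\<close> equal \<open>3\<close>, \<open>5\<close>, \<open>7\<close> at \<open>p = 2\<close>, so a prime \<open>p > 2\<close> with \<open>p = 2\<close> modulo
  \<open>11025 = 3\<^sup>2 * 5\<^sup>2 * 7\<^sup>2\<close> makes them exactly divisible by \<open>3\<close>, \<open>5\<close>, \<open>7\<close>; the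
  even numbers \<open>2p + 2\<close> and \<open>2p + 4\<close> are treated with the primes \<open>2\<close> and \<open>3\<close>. That there are
  infinitely many such primes is Dirichlet's theorem, proved here for all odd moduli
  (\<open>dirichlet_primes_odd_modulus\<close>).

  The proof of Dirichlet's theorem follows Shapiro. For a character \<open>\<chi>\<close> modulo \<open>m\<close> put
  \<open>S(\<chi>, N) = (\<Sum>n\<le>N. \<chi> n * mangoldt n / n)\<close>. Mertens' estimate gives \<open>S = ln N + O(1)\<close> for the principal
  character. For the other characters \<open>L(1, \<chi>) * S\<close> is bounded, so \<open>S = O(1)\<close> if \<open>L(1, \<chi>) \<noteq> 0\<close>; if
  \<open>L(1, \<chi>) = 0\<close>, Moebius inversion gives \<open>S = - ln N + O(1)\<close>. The sum of \<open>S(\<chi>, N)\<close> over all \<open>\<chi>\<close> is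
  nonnegative, because it only counts the \<open>n\<close> congruent to \<open>1\<close>; hence at most one \<open>L(1, \<chi>)\<close> vanishes,
  and a vanishing one belongs to a real character, since \<open>\<chi>\<close> and its conjugate vanish together.
  Real characters are excluded by Monsky's argument with a Lambert series
  (\<open>L_one_nonzero_if_real\<close>). Once all \<open>L(1, \<chi>)\<close> are nonzero, orthogonality of the characters shows
  that the sum of \<open>mangoldt n / n\<close> over any class prime to \<open>m\<close> diverges, and the prime powers
  that are not primes contribute a bounded amount to it.

  The last claim needs only congruences: \<open>q\<close> is \<open>3\<close> modulo \<open>4\<close>, so \<open>q + 1 = 2 * p\<close> forces \<open>p = 2\<close> and
  \<open>q = 3\<close>, which is not in the class.
\<close>

section \<open>Divisor sums and partial summation\<close>

text \<open>
  Both sides run over the pairs \<open>(d, e)\<close> with \<open>d * e \<le> N\<close>. All estimates below are done on such finite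
  sums, with the natural number quotient \<open>N div d\<close> in place of \<open>N / d\<close>.
\<close>
lemma sum_divisors_reorder:
  fixes g :: "nat \<Rightarrow> nat \<Rightarrow> 'a::comm_monoid_add"
  shows "(\<Sum>n=1..N. \<Sum>d | d dvd n. g d (n div d)) = (\<Sum>d=1..N. \<Sum>e=1..N div d. g d e)"
proof -
  have "(\<Sum>n=1..N. \<Sum>d | d dvd n. g d (n div d))
      = (\<Sum>(n,d)\<in>(SIGMA n:{1..N}. {d. d dvd n}). g d (n div d))"
    by (rule sum.Sigma) auto
  also have "\<dots> = (\<Sum>(d,e)\<in>(SIGMA d:{1..N}. {1..N div d}). g d e)"
    by (rule sum.reindex_bij_witness[of _ "\<lambda>(d,e). (d * e, d)" "\<lambda>(n,d). (d, n div d)"])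
       (auto simp: div_le_mono less_eq_div_iff_mult_less_eq mult.commute Suc_le_eq
             dest: dvd_imp_le intro!: Nat.gr0I intro: order.trans[OF dvd_imp_le])
  also have "\<dots> = (\<Sum>d=1..N. \<Sum>e=1..N div d. g d e)"
    by (rule sum.Sigma [symmetric]) auto
  finally show ?thesis .
qed

lemma sum_divisors_swap:
  fixes g :: "nat \<Rightarrow> nat \<Rightarrow> 'a::comm_monoid_add"
  assumes "n > 0"
  shows "(\<Sum>d | d dvd n. \<Sum>e | e dvd n div d. g d e) = (\<Sum>e | e dvd n. \<Sum>d | d dvd n div e. g d e)"
proof -
  have fin: "finite {d. d dvd k}" if "k dvd n" for k
    using that assms by (metis dvd_pos_nat finite_divisors_nat)
  have swap: "e dvd n \<and> d dvd n div e" if "d dvd n" "e dvd n div d" for d e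
  proof -
    have "d * e dvd n" "d > 0" "e > 0"
      using that assms by (metis dvd_mult_div_cancel mult_dvd_mono dvd_refl dvd_pos_nat, auto intro!: Nat.gr0I)
    thus ?thesis by (metis dvd_mult_right dvd_mult_imp_div mult.commute)
  qed
  note swap1 = swap[THEN conjunct1] and swap2 = swap[THEN conjunct2]
  have "(\<Sum>d | d dvd n. \<Sum>e | e dvd n div d. g d e)
      = (\<Sum>(d,e)\<in>(SIGMA d:{d. d dvd n}. {e. e dvd n div d}). g d e)"
    using assms by (intro sum.Sigma) (auto intro!: fin div_dvd_iff_mult[THEN iffD2])
  also have "\<dots> = (\<Sum>(e,d)\<in>(SIGMA e:{e. e dvd n}. {d. d dvd n div e}). g d e)"
      by (rule sum.reindex_bij_witness[of _ prod.swap prod.swap]) (auto intro: swap1 swap2)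
  also have "\<dots> = (\<Sum>e | e dvd n. \<Sum>d | d dvd n div e. g d e)"
    using assms by (intro sum.Sigma [symmetric]) (auto intro!: fin div_dvd_iff_mult[THEN iffD2])
  finally show ?thesis .
qed

lemma sum_by_parts:
  fixes c :: "nat \<Rightarrow> complex" and f :: "nat \<Rightarrow> real"
  assumes "a \<le> b"
  shows "(\<Sum>k=a..<b. c k * f k)
       = (\<Sum>k=a..<b. c k) * f b + (\<Sum>k=a..<b. (\<Sum>j=a..<Suc k. c j) * (f k - f (Suc k)))"
  using assms
proof (induction b rule: dec_induct)
  case (step b)
  define R where "R = (\<Sum>k=a..<b. (\<Sum>j=a..<Suc k. c j) * (f k - f (Suc k)))"
  have "(\<Sum>k=a..<Suc b. (\<Sum>j=a..<Suc k. c j) * (f k - f (Suc k)))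
      = R + (\<Sum>k=a..<Suc b. c k) * (f b - f (Suc b))"
    unfolding R_def using step.hyps(1) by (rule sum.atLeastLessThan_Suc)
  moreover have "(\<Sum>k=a..<Suc b. c k) = (\<Sum>k=a..<b. c k) + c b"
    "(\<Sum>k=a..<Suc b. c k * f k) = (\<Sum>k=a..<b. c k * f k) + c b * f b"
    using step.hyps(1) by (rule sum.atLeastLessThan_Suc)+
  ultimately show ?case using step.IH unfolding R_def[symmetric]
    by (simp only: of_real_diff) (simp add: ring_distribs)
qed simp

text \<open>
  Abel summation: by parts, the sum is a combination of the partial sums of \<open>c\<close> with nonnegative
  weights \<open>f k - f (Suc k)\<close> and \<open>f b\<close>, and these weights add up to \<open>f a\<close>.
\<close>
lemma norm_sum_decreasing_le:
  fixes c :: "nat \<Rightarrow> complex" and f :: "nat \<Rightarrow> real"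
  assumes C: "\<And>n. norm (\<Sum>k=a..<n. c k) \<le> C"
    and anti: "\<And>k. k \<ge> a \<Longrightarrow> f (Suc k) \<le> f k" and nonneg: "\<And>k. k \<ge> a \<Longrightarrow> f k \<ge> 0"
  shows "norm (\<Sum>k=a..<b. c k * f k) \<le> C * f a"
proof (cases "a \<le> b")
  case True
  have "norm (\<Sum>k=a..<b. c k * f k)
      \<le> norm ((\<Sum>k=a..<b. c k) * f b) + (\<Sum>k=a..<b. norm ((\<Sum>j=a..<Suc k. c j) * (f k - f (Suc k))))"
    unfolding sum_by_parts[OF True, of c f] by (intro norm_triangle_le add_mono order_refl norm_sum)
  also have "\<dots> \<le> C * f b + (\<Sum>k=a..<b. C * (f k - f (Suc k)))"
  proof (intro add_mono sum_mono)
    show "norm ((\<Sum>k=a..<b. c k) * f b) \<le> C * f b"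
      using C[of b] nonneg[OF True] by (simp add: norm_mult mult_right_mono)
    fix k assume k: "k \<in> {a..<b}"
    have "norm (complex_of_real (f k) - complex_of_real (f (Suc k))) = f k - f (Suc k)"
      using anti[of k] k by (metis abs_of_nonneg atLeastLessThan_iff diff_ge_0_iff_ge norm_of_real of_real_diff)
    thus "norm ((\<Sum>j=a..<Suc k. c j) * (f k - f (Suc k))) \<le> C * (f k - f (Suc k))"
      using C[of "Suc k"] anti[of k] k by (simp add: norm_mult mult_right_mono del: sum.op_ivl_Suc)
  qed
  also have "\<dots> = C * f a"
  proof -
    have "(\<Sum>k=a..<b. f k - f (Suc k)) = f a - f b"
      using sum_Suc_diff'[OF True, of "\<lambda>k. - f k"] by simp
    thus ?thesis by (simp only: sum_distrib_left[symmetric]) (simp add: algebra_simps)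
  qed
  finally show ?thesis .
next
  case False
  have "C \<ge> 0" using C[of a] by simp
  with False nonneg[of a] show ?thesis by simp
qed

section \<open>The estimates of Chebyshev and Mertens\<close>

lemma real_div_nat_bounds:
  fixes N d :: nat
  shows "real (N div d) \<le> N / d" and "d > 0 \<Longrightarrow> N / d - real (N div d) \<le> 1"
proof -
  show "real (N div d) \<le> N / d" by (rule of_nat_div_le_of_nat)
  assume "d > 0"
  hence "N mod d < d" by simp
  moreover have "N = N div d * d + N mod d" by simp
  ultimately have "N < (N div d + 1) * d" unfolding distrib_right by linarith
  hence "real N < (real (N div d) + 1) * d" by (metis of_nat_1 of_nat_add of_nat_less_iff of_nat_mult)
  thus "N / d - real (N div d) \<le> 1" using \<open>d > 0\<close> by (simp add: field_simps)
qed

lemma ln_fact_eq_sum_mangoldt: "ln (fact N :: real) = (\<Sum>d=1..N. mangoldt d * real (N div d))"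
proof -
  have "ln (fact N :: real) = (\<Sum>n=1..N. ln (real n))"
    by (induction N) (simp_all add: ln_mult)
  also have "\<dots> = (\<Sum>n=1..N. \<Sum>d | d dvd n. mangoldt d)"
    by (intro sum.cong) (auto simp: mangoldt_sum)
  also have "\<dots> = (\<Sum>d=1..N. mangoldt d * real (N div d))"
    using sum_divisors_reorder[of "\<lambda>d e. mangoldt d :: real" N] by (simp add: mult.commute)
  finally show ?thesis .
qed

lemma ln_fact_bounds:
  shows "ln (fact N :: real) \<le> N * ln N" and "ln (fact N :: real) \<ge> N * ln N - N"
proof -
  show "ln (fact N :: real) \<le> N * ln N"
  proof (cases "N = 0")
    case False
    have "(fact N :: real) \<le> of_nat (N ^ N)" by (metis fact_le_power of_nat_fact of_nat_le_iff order_refl)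
    hence "ln (fact N :: real) \<le> ln (real N ^ N)" using False by (subst ln_le_cancel_iff) auto
    also have "\<dots> = N * ln N" using False by (simp add: ln_realpow)
    finally show ?thesis .
  qed simp
  show "ln (fact N :: real) \<ge> N * ln N - N"
  proof (induction N)
    case (Suc N)
    show ?case
    proof (cases "N = 0")
      case False
      have "ln (real (Suc N)) - ln (real N) = ln (real (Suc N) / real N)"
        using False by (subst ln_div) auto
      also have "real (Suc N) / real N = 1 + 1 / N"
        using False by (simp add: field_simps)
      also have "ln (1 + 1 / real N) \<le> 1 / N" by (intro ln_add_one_self_le_self) simp
      finally have "N * (ln (real (Suc N)) - ln (real N)) \<le> 1" using False by (simp add: field_simps)
      moreover have "ln (fact (Suc N) :: real) = ln (real (Suc N)) + ln (fact N)"
        by (simp add: ln_mult)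
      moreover have "real (Suc N) * ln (real (Suc N)) - real (Suc N)
          = N * (ln (real (Suc N)) - ln (real N)) + N * ln N + ln (real (Suc N)) - N - 1"
        by (simp add: algebra_simps)
      ultimately show ?thesis using Suc by linarith
    qed simp
  qed simp
qed

text \<open>
  In \<open>ln ((2k)!) - 2 * ln (k!)\<close>, the logarithm of a central binomial coefficient, each \<open>mangoldt d\<close> has the
  nonnegative coefficient \<open>2k div d - 2 * (k div d)\<close>, which is \<open>1\<close> for \<open>k < d \<le> 2k\<close>. As the binomial
  coefficient is at most \<open>4 ^ k\<close>, this bounds the sum over \<open>{k<..2k}\<close>; the claim follows by
  repeated halving.
\<close>
lemma chebyshev_upper: "(\<Sum>n=1..N. mangoldt n :: real) \<le> 4 * real N"
proof (induction N rule: less_induct)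
  case (less N)
  have doubling: "(\<Sum>n=1..2*k. mangoldt n :: real) \<le> 2 * k + (\<Sum>n=1..k. mangoldt n)" for k :: nat
  proof -
    have "(\<Sum>n=k+1..2*k. mangoldt n :: real)
       \<le> (\<Sum>d=1..2*k. mangoldt d * (real (2 * k div d) - 2 * real (k div d)))"
    proof -
      have nn: "real (2 * k div d) - 2 * real (k div d) \<ge> 0" for d
      proof -
        have "2 * (k div d) \<le> 2 * k div d"
          by (cases "d = 0") (auto simp: less_eq_div_iff_mult_less_eq)
        thus ?thesis by linarith
      qed
      have "(\<Sum>n=k+1..2*k. mangoldt n :: real)
          = (\<Sum>d=k+1..2*k. mangoldt d * (real (2 * k div d) - 2 * real (k div d)))"
      proof (intro sum.cong refl)
        fix d assume d: "d \<in> {k+1..2*k}"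
        hence "2 * k div d = 1" "k div d = 0" by (auto simp: div_nat_eqI)
        thus "mangoldt d = mangoldt d * (real (2 * k div d) - 2 * real (k div d))" by simp
      qed
      also have "\<dots> \<le> (\<Sum>d=1..2*k. mangoldt d * (real (2 * k div d) - 2 * real (k div d)))"
        by (intro sum_mono2) (auto intro!: mult_nonneg_nonneg mangoldt_nonneg nn simp del: diff_ge_0_iff_ge)
      finally show ?thesis .
    qed
    also have "\<dots> = ln (fact (2*k)) - 2 * (\<Sum>d=1..2*k. mangoldt d * real (k div d))"
      unfolding ln_fact_eq_sum_mangoldt by (simp add: right_diff_distrib sum_subtractf sum_distrib_left mult.left_commute)
    also have "(\<Sum>d=1..2*k. mangoldt d * real (k div d)) = (\<Sum>d=1..k. mangoldt d * real (k div d) :: real)"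
      by (rule sum.mono_neutral_right) auto
    also have "\<dots> = ln (fact k)" by (simp add: ln_fact_eq_sum_mangoldt)
    also have "ln (fact (2*k)) - 2 * ln (fact k) = ln (real ((2 * k) choose k))"
    proof -
      have "real ((2 * k) choose k) = fact (2 * k) / (fact k * fact k)"
        using binomial_fact[of k "2 * k", where ?'a = real] by (simp add: mult_2)
      also have "ln \<dots> = ln (fact (2 * k)) - (ln (fact k) + ln (fact k))"
        by (subst ln_div) (simp_all add: ln_mult)
      finally show ?thesis by simp
    qed
    also have "\<dots> \<le> ln (2 ^ (2 * k))"
    proof -
      have "real ((2 * k) choose k) \<le> real (2 ^ (2 * k))"
        using binomial_le_pow2[of "2 * k" k] by (simp only: of_nat_le_iff)
      thus ?thesis by (intro ln_mono) simp_all
    qed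
    also have "\<dots> = 2 * k * ln 2" by (simp add: ln_realpow)
    also have "\<dots> \<le> real (2 * k) * 1"
      using ln_le_minus_one[of "2 :: real"] by (intro mult_left_mono) auto
    finally have "(\<Sum>n=k+1..2*k. mangoldt n :: real) \<le> 2 * k" by simp
    moreover have "(\<Sum>n=1..2*k. mangoldt n :: real) = (\<Sum>n=1..k. mangoldt n) + (\<Sum>n=k+1..2*k. mangoldt n)"
      using sum.ub_add_nat[of 1 k mangoldt k] by (simp add: mult_2)
    ultimately show ?thesis by simp
  qed
  obtain k where "N = 2 * k \<or> N = Suc (2 * k)" by (metis oddE evenE Suc_eq_plus1)
  thus ?case
  proof
    assume N: "N = 2 * k"
    show ?thesis
    proof (cases "k = 0")
      case False
      with less.IH[of k] doubling[of k] N show ?thesis by simp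
    qed (use N in simp)
  next
    assume N: "N = Suc (2 * k)"
    have "mangoldt (Suc (2 * k)) \<le> ln (real (Suc (2 * k)))" by (intro mangoldt_le) simp
    also have "\<dots> \<le> 2 * k" using ln_le_minus_one[of "real (Suc (2*k))"] by simp
    finally show ?thesis using less.IH[of k] doubling[of k] N by simp
  qed
qed

text \<open>
  Replacing \<open>N div d\<close> by \<open>N / d\<close> in \<open>ln (N!) = (\<Sum>d\<le>N. mangoldt d * (N div d))\<close> costs at most
  \<open>\<Sum>d\<le>N. mangoldt d\<close>, which is \<open>O(N)\<close>, and \<open>ln (N!)\<close> is \<open>N * ln N + O(N)\<close>.
\<close>
lemma mertens: "\<bar>(\<Sum>n=1..N. mangoldt n / n) - ln N\<bar> \<le> 5"
proof (cases "N = 0")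
  case False
  let ?M = "\<Sum>n=1..N. mangoldt n / n :: real"
  have "N * ?M = (\<Sum>d=1..N. mangoldt d * (real N / d))"
    by (simp add: sum_distrib_left mult_ac)
  moreover have "(\<Sum>d=1..N. mangoldt d * (real N / d)) \<ge> ln (fact N)"
    unfolding ln_fact_eq_sum_mangoldt
    by (intro sum_mono mult_left_mono mangoldt_nonneg) (rule real_div_nat_bounds)
  moreover have "(\<Sum>d=1..N. mangoldt d * (real N / d)) - ln (fact N) \<le> (\<Sum>d=1..N. mangoldt d * 1)"
    unfolding ln_fact_eq_sum_mangoldt sum_subtractf [symmetric] right_diff_distrib [symmetric]
    by (intro sum_mono mult_left_mono mangoldt_nonneg) (use real_div_nat_bounds(2) in auto)
  ultimately have "N * ?M \<ge> N * ln N - N" "N * ?M \<le> N * ln N + 4 * N"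
    using chebyshev_upper[of N] ln_fact_bounds[of N] by simp_all
  hence "N * (ln N - 1) \<le> N * ?M" "N * ?M \<le> N * (ln N + 4)"
    by (simp_all only: right_diff_distrib distrib_left mult_1_right mult.commute[of 4])
  hence "ln N - 1 \<le> ?M" "?M \<le> ln N + 4" using False by simp_all
  thus ?thesis by linarith
qed simp

section \<open>Dirichlet characters and their sums\<close>

locale dirichlet_character =
  fixes m :: nat and \<chi> :: "nat \<Rightarrow> complex"
  assumes modulus_gt_1: "m > 1"
    and mult: "\<chi> (a * b) = \<chi> a * \<chi> b"
    and periodic: "\<chi> (a + m) = \<chi> a"
    and eq_0_iff: "\<chi> a = 0 \<longleftrightarrow> \<not> coprime a m"
begin

lemma one [simp]: "\<chi> (Suc 0) = 1"
proof -
  have "\<chi> 1 * \<chi> 1 = \<chi> 1" using mult[of 1 1] by simp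
  moreover have "\<chi> 1 \<noteq> 0" by (simp add: eq_0_iff)
  ultimately show ?thesis by simp
qed

lemma mod_eq: "\<chi> (a mod m) = \<chi> a"
proof -
  have "\<chi> (b + k * m) = \<chi> b" for b k
    by (induction k) (simp_all add: periodic add.assoc[symmetric] add.commute[of m])
  from this[of "a mod m" "a div m"] show ?thesis by simp
qed

lemma cong_eq: "[a = b] (mod m) \<Longrightarrow> \<chi> a = \<chi> b"
  by (metis mod_eq cong_def)

lemma power: "\<chi> (a ^ k) = \<chi> a ^ k"
  by (induction k) (simp_all add: mult)

lemma power_totient: "coprime a m \<Longrightarrow> \<chi> a ^ totient m = 1"
  using cong_eq[OF euler_theorem[of a m]] by (simp add: power)

lemma totient_modulus_pos: "totient m > 0"
  using modulus_gt_1 by simp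

lemma norm_le_1: "norm (\<chi> a) \<le> 1"
  using power_eq_1_iff[OF power_totient[of a]] totient_modulus_pos eq_0_iff[of a]
  by (cases "coprime a m") auto

end

locale nonprincipal_character = dirichlet_character +
  assumes nonprincipal: "\<exists>u. coprime u m \<and> \<chi> u \<noteq> 1"
begin

text \<open>
  Multiplication by \<open>u\<close> permutes the residues and multiplies the sum by \<open>\<chi> u \<noteq> 1\<close>.
\<close>
lemma sum_period_eq_0: "(\<Sum>k<m. \<chi> k) = 0"
proof -
  obtain u where u: "coprime u m" "\<chi> u \<noteq> 1" using nonprincipal by auto
  have "inj_on (\<lambda>k. u * k mod m) {..<m}"
  proof (rule inj_onI)
    fix x y assume xy: "x \<in> {..<m}" "y \<in> {..<m}" "u * x mod m = u * y mod m"
    hence "[x = y] (mod m)" using u by (metis cong_def cong_mult_lcancel_nat)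
    with xy show "x = y" by (simp add: cong_def)
  qed
  moreover have "(\<lambda>k. u * k mod m) ` {..<m} \<subseteq> {..<m}" using modulus_gt_1 by auto
  ultimately have "bij_betw (\<lambda>k. u * k mod m) {..<m} {..<m}"
    by (simp add: bij_betw_def endo_inj_surj)
  hence "(\<Sum>k<m. \<chi> k) = (\<Sum>k<m. \<chi> (u * k mod m))"
    by (rule sum.reindex_bij_betw [symmetric])
  also have "\<dots> = \<chi> u * (\<Sum>k<m. \<chi> k)" by (simp add: mod_eq mult sum_distrib_left)
  finally show ?thesis using u by simp
qed

lemma norm_sum_le: "norm (\<Sum>k=a..<b. \<chi> k) \<le> 2 * real m"
proof -
  have prefix: "norm (\<Sum>k<n. \<chi> k) \<le> m" for n
  proof (induction n rule: less_induct)
    case (less n)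
    show ?case
    proof (cases "n < m")
      case True
      have "norm (\<Sum>k<n. \<chi> k) \<le> (\<Sum>k<n. 1)" by (intro sum_norm_le norm_le_1)
      with True show ?thesis by simp
    next
      case False
      hence "(\<Sum>k<n. \<chi> k) = (\<Sum>k<m. \<chi> k) + (\<Sum>k=m..<n. \<chi> k)"
        by (simp add: sum.atLeastLessThan_concat atLeast0LessThan [symmetric])
      also have "(\<Sum>k=m..<n. \<chi> k) = (\<Sum>k<n - m. \<chi> (k + m))"
        using False sum.shift_bounds_nat_ivl[of \<chi> 0 m "n - m"] by (simp add: atLeast0LessThan)
      finally show ?thesis using False less[of "n - m"] modulus_gt_1
        by (simp add: sum_period_eq_0 periodic)
    qed
  qed
  show ?thesis
  proof (cases "a \<le> b")
    case True
    hence "(\<Sum>k=a..<b. \<chi> k) = (\<Sum>k<b. \<chi> k) - (\<Sum>k<a. \<chi> k)"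
      by (simp add: sum_diff_nat_ivl atLeast0LessThan [symmetric])
    thus ?thesis using prefix[of a] prefix[of b] norm_triangle_ineq4[of "\<Sum>k<b. \<chi> k" "\<Sum>k<a. \<chi> k"]
      by simp
  qed simp
qed

end

text \<open>
  The value at \<open>1\<close> of the Dirichlet series of \<open>\<chi>\<close>. The term for \<open>n = 0\<close> vanishes because \<open>x / 0 = 0\<close>.
\<close>
definition L_one :: "(nat \<Rightarrow> complex) \<Rightarrow> complex" where
  "L_one \<chi> = (\<Sum>n. \<chi> n / n)"

definition mangoldt_sum_upto :: "(nat \<Rightarrow> complex) \<Rightarrow> nat \<Rightarrow> complex" where
  "mangoldt_sum_upto \<chi> N = (\<Sum>n=1..N. \<chi> n * of_real (mangoldt n / n))"

context nonprincipal_character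
begin

lemma norm_sum_over_n_le:
  assumes "a \<ge> 1" 
  shows "norm (\<Sum>n=a..<b. \<chi> n / n) \<le> 2 * real m / real a"
  using norm_sum_decreasing_le[of \<chi> a "2 * real m" "\<lambda>n. 1 / n" b] norm_sum_le[of a] assms
  by (simp add: field_simps)

lemma summable_over_n: "summable (\<lambda>n. \<chi> n / n)"
  unfolding summable_Cauchy
proof safe
  fix e :: real assume e: "e > 0"
  obtain N :: nat where N: "real N > 2 * real m / e" using reals_Archimedean2 by blast
  have "norm (\<Sum>n=a..<b. \<chi> n / n) < e" if "a \<ge> N" for a b
  proof -
    have "2 * real m / e \<ge> 0" using e by simp
    hence a: "real a > 2 * real m / e" "a \<ge> 1" using N that by (linarith, cases a, auto)
    hence "2 * m / real a < e" using e by (simp add: field_simps)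
    thus ?thesis using norm_sum_over_n_le[OF a(2), of b] by simp
  qed
  thus "\<exists>N. \<forall>a\<ge>N. \<forall>b. norm (\<Sum>n=a..<b. \<chi> n / n) < e" by blast
qed

lemma L_one_tail: "norm ((\<Sum>n=1..N. \<chi> n / n) - L_one \<chi>) \<le> 2 * real m / (real N + 1)"
proof -
  have lim: "(\<lambda>b. norm ((\<Sum>n=1..N. \<chi> n / n) - (\<Sum>n<b. \<chi> n / n)))
           \<longlonglongrightarrow> norm ((\<Sum>n=1..N. \<chi> n / n) - L_one \<chi>)"
    unfolding L_one_def by (intro tendsto_intros summable_LIMSEQ summable_over_n)
  have "norm ((\<Sum>n=1..N. \<chi> n / n) - (\<Sum>n<b. \<chi> n / n)) \<le> 2 * real m / (real N + 1)" if b: "b \<ge> N + 1" for b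
  proof -
    have "(\<Sum>n<b. \<chi> n / n) = (\<Sum>n=0..<N+1. \<chi> n / n) + (\<Sum>n=N+1..<b. \<chi> n / n)"
      using b by (subst sum.atLeastLessThan_concat) (auto simp: atLeast0LessThan)
    also have "(\<Sum>n=0..<N+1. \<chi> n / n) = (\<Sum>n=1..N. \<chi> n / n)"
      by (intro sum.mono_neutral_right) auto
    finally show ?thesis using norm_sum_over_n_le[of "N + 1" b] by (simp add: add.commute)
  qed
  thus ?thesis by (intro LIMSEQ_le_const2[OF lim]) blast
qed

lemma ln_over_n_bounded: "\<exists>C. \<forall>N. norm (\<Sum>n=1..N. \<chi> n * of_real (ln n / n)) \<le> C"
proof -
  \<comment> \<open>\<open>ln x / x\<close> decreases only from \<open>x = e\<close> on, so the terms up to \<open>2\<close> are split off below.\<close>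
  have anti: "ln (real (Suc n)) / real (Suc n) \<le> ln (real n) / real n" if n: "n \<ge> 3" for n
  proof -
    have "1 \<le> ln (3::real)" using exp_le by (simp add: ln_ge_iff)
    also have "\<dots> \<le> ln (real n)" using n by simp
    finally have "1 \<le> ln (real n)" .
    moreover have "ln (real (Suc n)) \<le> ln (real n) + 1 / n"
    proof -
      have "real (Suc n) = real n * (1 + 1 / real n)" using n by (simp add: field_simps)
      hence "ln (real (Suc n)) = ln (real n * (1 + 1 / real n))" by simp
      also have "\<dots> = ln (real n) + ln (1 + 1 / real n)" using n by (subst ln_mult) (auto simp: add_nonneg_eq_0_iff)
      also have "ln (1 + 1 / real n) \<le> 1 / n" by (intro ln_add_one_self_le_self) simp
      finally show ?thesis by simp
    qed
    ultimately have "n * ln (real (Suc n)) \<le> n * (ln (real n) + 1 / n)"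
      by (intro mult_left_mono) auto
    also have "\<dots> = n * ln n + 1" using n by (simp add: algebra_simps)
    also have "\<dots> \<le> n * ln n + ln n" using \<open>1 \<le> ln (real n)\<close> by simp
    finally show ?thesis using n by (simp add: field_simps)
  qed
  let ?f = "\<lambda>n. \<chi> n * of_real (ln n / n)"
  have "norm (\<Sum>n=1..N. ?f n) \<le> norm (?f 2) + 2 * real m * (ln 3 / 3)" for N
  proof -
    consider "N = 0" | "N = 1" | "N \<ge> 2" by linarith
    thus ?thesis
    proof cases
      case 3
      hence "{1..N} = {1, 2} \<union> {3..<Suc N}" by auto
      hence "(\<Sum>n=1..N. ?f n) = (\<Sum>n\<in>{1,2}. ?f n) + (\<Sum>n=3..<Suc N. ?f n)"
        by (simp only:) (rule sum.union_disjoint, auto)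
      also have "(\<Sum>n\<in>{1,2}. ?f n) = ?f 2" by simp
      finally have "norm (\<Sum>n=1..N. ?f n) \<le> norm (?f 2) + norm (\<Sum>n=3..<Suc N. ?f n)"
        by (simp only: norm_triangle_ineq)
      also have "norm (\<Sum>n=3..<Suc N. ?f n) \<le> 2 * real m * (ln 3 / 3)"
        using norm_sum_decreasing_le[of \<chi> 3 "2 * real m" "\<lambda>n. ln n / n" "Suc N", OF norm_sum_le anti]
        by simp
      finally show ?thesis by simp
    qed auto
  qed
  thus ?thesis by blast
qed

lemma inverse_Suc_div_le:
  fixes N d :: nat
  assumes "N \<ge> 1" "d \<ge> 1"
  shows "1 / (real (N div d) + 1) \<le> real d / real N"
  using real_div_nat_bounds(2)[of d N] assms by (simp add: field_simps)

lemma L_one_tail_div: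
  assumes "N \<ge> 1" "d \<ge> 1"
  shows "norm ((\<Sum>n=1..N div d. \<chi> n / n) - L_one \<chi>) \<le> 2 * real m * (real d / real N)"
proof -
  have "2 * real m * (1 / (real (N div d) + 1)) \<le> 2 * real m * (real d / real N)"
    using assms by (intro mult_left_mono inverse_Suc_div_le) auto
  thus ?thesis using L_one_tail[of "N div d"] by (simp add: add.commute)
qed

text \<open>
  Writing \<open>ln n\<close> as a sum of \<open>mangoldt\<close> over the divisors of \<open>n\<close> turns the bounded sum of
  \<open>\<chi> n * ln n / n\<close> into \<open>\<Sum>d\<le>N. \<chi> d * mangoldt d / d * T (N div d)\<close>, where \<open>T\<close> denotes the partial sums of
  \<open>L_one \<chi>\<close>. Since \<open>T (N div d)\<close> differs from the limit by \<open>O(d / N)\<close>, the error is \<open>O(1)\<close> by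
  Chebyshev's estimate.
\<close>
lemma L_one_times_mangoldt_sum_bounded:
  "\<exists>C. \<forall>N. norm (L_one \<chi> * mangoldt_sum_upto \<chi> N) \<le> C"
proof -
  obtain C where C: "norm (\<Sum>n=1..N. \<chi> n * of_real (ln n / n)) \<le> C" for N
    using ln_over_n_bounded by (elim exE, intro that) (erule spec)
  define T where "T = (\<lambda>N. \<Sum>n=1..N. \<chi> n / n)"
  have "norm (L_one \<chi> * mangoldt_sum_upto \<chi> N) \<le> C + 8 * real m" for N
  proof (cases "N = 0")
    case True
    thus ?thesis using C[of 0] by (simp add: mangoldt_sum_upto_def)
  next
    case False
    hence N: "N \<ge> 1" by simp
    have "(\<Sum>n=1..N. \<chi> n * of_real (ln n / n))
        = (\<Sum>n=1..N. \<Sum>d | d dvd n. (\<chi> d * of_real (mangoldt d / d)) * (\<chi> (n div d) / (n div d)))"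
    proof (rule sum.cong)
      fix n assume n: "n \<in> {1..N}"
      have "\<chi> n * of_real (ln n / n) = (\<Sum>d | d dvd n. \<chi> n * of_real (mangoldt d / n))"
        using mangoldt_sum[of n, where ?'a = complex] n
        by (simp add: sum_distrib_left[symmetric] sum_divide_distrib[symmetric])
      also have "\<dots> = (\<Sum>d | d dvd n. (\<chi> d * of_real (mangoldt d / d)) * (\<chi> (n div d) / (n div d)))"
        using n by (intro sum.cong) (auto elim!: dvdE simp: mult)
      finally show "\<chi> n * of_real (ln n / n) = \<dots>" .
    qed auto
    also have "\<dots> = (\<Sum>d=1..N. (\<chi> d * of_real (mangoldt d / d)) * T (N div d))"
      using sum_divisors_reorder[of "\<lambda>d e. (\<chi> d * of_real (mangoldt d / d)) * (\<chi> e / e)" N]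
      by (simp only: T_def sum_distrib_left)
    finally have ln_eq: "(\<Sum>n=1..N. \<chi> n * of_real (ln n / n))
        = (\<Sum>d=1..N. (\<chi> d * of_real (mangoldt d / d)) * T (N div d))" .
    have eq: "L_one \<chi> * mangoldt_sum_upto \<chi> N = (\<Sum>n=1..N. \<chi> n * of_real (ln n / n))
        - (\<Sum>d=1..N. (\<chi> d * of_real (mangoldt d / d)) * (T (N div d) - L_one \<chi>))"
      unfolding ln_eq mangoldt_sum_upto_def right_diff_distrib sum_subtractf sum_distrib_right[symmetric]
      by (simp only: diff_diff_eq2 add_diff_cancel_left' mult.commute)
    have "norm (\<Sum>d=1..N. (\<chi> d * of_real (mangoldt d / d)) * (T (N div d) - L_one \<chi>))
        \<le> (\<Sum>d=1..N. (1 * (mangoldt d / d)) * (2 * real m * (real d / real N)))"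
    proof (rule sum_norm_le)
      fix d assume "d \<in> {1..N}"
      hence "norm (T (N div d) - L_one \<chi>) \<le> 2 * real m * (real d / real N)"
        unfolding T_def using N by (intro L_one_tail_div) auto
      moreover have "norm (complex_of_real (mangoldt d / d)) = mangoldt d / d"
        unfolding norm_of_real by (simp add: mangoldt_nonneg)
      ultimately show "norm ((\<chi> d * of_real (mangoldt d / d)) * (T (N div d) - L_one \<chi>))
          \<le> (1 * (mangoldt d / d)) * (2 * real m * (real d / real N))"
        unfolding norm_mult by (intro mult_mono norm_le_1) (auto simp: mangoldt_nonneg)
    qed
    also have "\<dots> = 2 * real m / real N * (\<Sum>d=1..N. mangoldt d)"
      unfolding sum_distrib_left by (intro sum.cong) auto
    also have "\<dots> \<le> 2 * real m / real N * (4 * real N)" by (intro mult_left_mono chebyshev_upper) simp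
    also have "\<dots> = 8 * real m" using N by simp
    finally show ?thesis unfolding eq
      using C[of N] by (intro order.trans[OF norm_triangle_ineq4] add_mono) auto
  qed
  thus ?thesis by blast
qed

end

section \<open>Moebius inversion and the case of a vanishing value at one\<close>

definition moebius :: "nat \<Rightarrow> real" where
  "moebius n = (if squarefree n then (-1) ^ card (prime_factors n) else 0)"

lemma abs_moebius_le_1: "\<bar>moebius n\<bar> \<le> 1"
  by (simp add: moebius_def power_abs)

lemma squarefree_prime_times_iff:
  fixes p e :: nat
  assumes "prime p" "\<not> p dvd e"
  shows "squarefree (p * e) \<longleftrightarrow> squarefree e"
  using assms by (metis prime_imp_coprime squarefree_mult_coprime squarefree_multD(2) squarefree_prime)

lemma moebius_prime_times:
  assumes "prime p" "\<not> p dvd e"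
  shows "moebius (p * e) = - moebius e"
proof -
  have "e > 0" using assms(2) by (intro Nat.gr0I) auto
  hence "prime_factors (p * e) = insert p (prime_factors e)"
    using assms(1) by (subst prime_factors_product) (auto simp: prime_prime_factors)
  moreover have "p \<notin> prime_factors e" using assms(2) by auto
  ultimately show ?thesis using squarefree_prime_times_iff[OF assms] by (simp add: moebius_def)
qed

text \<open>
  For a prime \<open>p\<close> dividing \<open>n\<close>, the squarefree divisors of \<open>n\<close> come in pairs \<open>e\<close>, \<open>p * e\<close> with
  \<open>p\<close> not dividing \<open>e\<close>, and the two contributions cancel.
\<close>
lemma sum_moebius_divisors:
  assumes "n > 0"
  shows "(\<Sum>d | d dvd n. moebius d) = (if n = 1 then 1 else 0)"
proof (cases "n = 1")
  case False
  then obtain p where p: "prime p" "p dvd n" by (metis prime_factor_nat)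
  define E where "E = {e. e dvd n \<and> squarefree e \<and> \<not> p dvd e}"
  have fin: "finite {d. d dvd n}" using assms by (simp add: finite_divisors_nat)
  hence finE: "finite E" by (rule rev_finite_subset) (auto simp: E_def)
  have "(\<Sum>d | d dvd n. moebius d) = (\<Sum>d | d dvd n \<and> squarefree d. moebius d)"
    using fin by (intro sum.mono_neutral_right) (auto simp: moebius_def)
  also have "{d. d dvd n \<and> squarefree d} = E \<union> (*) p ` E"
  proof (intro equalityI subsetI)
    fix d assume d: "d \<in> {d. d dvd n \<and> squarefree d}"
    show "d \<in> E \<union> (*) p ` E"
    proof (cases "p dvd d")
      case True
      then obtain e where e: "d = p * e" by auto
      have "\<not> p dvd e"
      proof
        assume "p dvd e"
        hence "p ^ 2 dvd d" by (simp add: e power2_eq_square mult_dvd_mono)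
        hence "is_unit p" using d by (auto simp: squarefree_def)
        thus False using p(1) by simp
      qed
      moreover have "e dvd n" "squarefree e"
        using d squarefree_multD(2)[of p e] by (auto simp: e dest: dvd_mult_right)
      ultimately show ?thesis by (auto simp: E_def e)
    qed (use d in \<open>auto simp: E_def\<close>)
  next
    fix d assume "d \<in> E \<union> (*) p ` E"
    thus "d \<in> {d. d dvd n \<and> squarefree d}"
      using p by (auto simp: E_def squarefree_prime_times_iff prime_imp_coprime intro!: divides_mult)
  qed
  also have "(\<Sum>d\<in>E \<union> (*) p ` E. moebius d) = (\<Sum>d\<in>E. moebius d) + (\<Sum>d\<in>(*) p ` E. moebius d)"
    using finE by (intro sum.union_disjoint) (auto simp: E_def)
  also have "(\<Sum>d\<in>(*) p ` E. moebius d) = (\<Sum>e\<in>E. moebius (p * e))"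
    using p(1) by (subst sum.reindex) (auto simp: inj_on_def prime_gt_0_nat)
  also have "\<dots> = (\<Sum>e\<in>E. - moebius e)"
    by (intro sum.cong refl moebius_prime_times p(1)) (auto simp: E_def)
  finally show ?thesis using False by (simp add: sum_negf)
qed (simp add: moebius_def)

text \<open>
  This is the inversion of \<open>mangoldt_sum\<close> with an additional constant: \<open>ln (N / d)\<close> is
  \<open>ln (N / n) + ln (n / d)\<close>, and the first summand is only seen by \<open>n = 1\<close>. With \<open>ln (N / d)\<close> instead of
  \<open>ln (n / d)\<close> the sum over \<open>d\<close> can later be taken outside the sum over \<open>n\<close>.
\<close>
lemma sum_moebius_ln:
  assumes "n > 0" "N > 0"
  shows "(\<Sum>d | d dvd n. moebius d * ln (N / d)) = (if n = 1 then ln N else 0) + mangoldt n"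
proof -
  have split: "ln (N / d) = (ln N - ln n) + ln (real (n div d))" if "d dvd n" for d
  proof -
    have "d > 0" "n div d > 0" "real (n div d) = n / d"
      using that assms by (auto simp: real_of_nat_div intro!: Nat.gr0I)
    thus ?thesis using assms by (simp add: ln_div)
  qed
  have "(\<Sum>d | d dvd n. moebius d * ln (real (n div d)))
      = (\<Sum>d | d dvd n. \<Sum>e | e dvd n div d. moebius d * mangoldt e)"
  proof (intro sum.cong refl)
    fix d assume "d \<in> {d. d dvd n}"
    hence "n div d \<noteq> 0" using assms by auto
    thus "moebius d * ln (real (n div d)) = (\<Sum>e | e dvd n div d. moebius d * mangoldt e)"
      by (simp add: sum_distrib_left[symmetric] mangoldt_sum)
  qed
  also have "\<dots> = (\<Sum>e | e dvd n. \<Sum>d | d dvd n div e. moebius d * mangoldt e)"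
    by (rule sum_divisors_swap) fact
  also have "\<dots> = (\<Sum>e | e dvd n. if e = n then mangoldt e else 0)"
  proof (intro sum.cong refl)
    fix e assume "e \<in> {e. e dvd n}"
    hence e: "e dvd n" "n div e > 0" using assms by auto
    hence "n div e = 1 \<longleftrightarrow> e = n" by (metis dvd_div_mult_self nat_mult_1 div_self assms(1) less_irrefl)
    thus "(\<Sum>d | d dvd n div e. moebius d * mangoldt e) = (if e = n then mangoldt e else 0)"
      using sum_moebius_divisors[OF e(2)] by (simp add: sum_distrib_right[symmetric])
  qed
  also have "\<dots> = mangoldt n" using assms by (simp add: finite_divisors_nat)
  finally have *: "(\<Sum>d | d dvd n. moebius d * ln (real (n div d))) = mangoldt n" .
  have "(\<Sum>d | d dvd n. moebius d * ln (N / d))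
      = (ln N - ln n) * (\<Sum>d | d dvd n. moebius d) + (\<Sum>d | d dvd n. moebius d * ln (real (n div d)))"
    unfolding sum_distrib_left sum.distrib[symmetric]
    by (intro sum.cong refl) (simp add: split ring_distribs mult_ac)
  thus ?thesis using sum_moebius_divisors[OF assms(1)] * by simp
qed

context nonprincipal_character
begin

text \<open>
  By \<open>sum_moebius_ln\<close> the left-hand side is
  \<open>\<Sum>d\<le>N. moebius d * \<chi> d / d * ln (N / d) * T (N div d)\<close> with the partial sums \<open>T\<close> of \<open>L_one \<chi>\<close>. These now
  tend to \<open>0\<close>, so \<open>T (N div d)\<close> is \<open>O(d / N)\<close>, and \<open>\<Sum>d\<le>N. ln (N / d)\<close> is at most \<open>N\<close>.
\<close>
lemma mangoldt_sum_if_L_one_eq_0: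
  assumes "L_one \<chi> = 0"
  shows "norm (of_real (ln (real N)) + mangoldt_sum_upto \<chi> N) \<le> 2 * real m"
proof (cases "N = 0")
  case True
  thus ?thesis by (simp add: mangoldt_sum_upto_def)
next
  case False
  hence N: "N \<ge> 1" by simp
  define T where "T = (\<lambda>N. \<Sum>n=1..N. \<chi> n / n)"
  define b where "b = (\<lambda>d. \<chi> d * of_real (moebius d / real d * ln (real N / real d)))"
  have "of_real (ln (real N)) + mangoldt_sum_upto \<chi> N
      = (\<Sum>n=1..N. if n = 1 then complex_of_real (ln (real N)) else 0) + mangoldt_sum_upto \<chi> N"
    using N by simp
  also have "\<dots> = (\<Sum>n=1..N. \<chi> n / n * of_real ((if n = 1 then ln (real N) else 0) + mangoldt n))"
    unfolding mangoldt_sum_upto_def sum.distrib[symmetric] by (intro sum.cong) (auto simp: field_simps)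
  also have "\<dots> = (\<Sum>n=1..N. \<Sum>d | d dvd n. b d * (\<chi> (n div d) / (n div d)))"
  proof (rule sum.cong)
    fix n assume n: "n \<in> {1..N}"
    have "\<chi> n / n * of_real ((if n = 1 then ln (real N) else 0) + mangoldt n)
        = (\<Sum>d | d dvd n. \<chi> n / n * of_real (moebius d * ln (real N / real d)))"
    proof -
      have "(if n = 1 then ln (real N) else 0) + mangoldt n = (\<Sum>d | d dvd n. moebius d * ln (real N / real d))"
        using sum_moebius_ln[of n N] n by simp
      thus ?thesis by (simp only: of_real_sum sum_distrib_left)
    qed
    also have "\<dots> = (\<Sum>d | d dvd n. b d * (\<chi> (n div d) / (n div d)))"
      using n by (intro sum.cong) (auto elim!: dvdE simp: mult b_def)
    finally show "\<chi> n / n * of_real ((if n = 1 then ln (real N) else 0) + mangoldt n) = \<dots>" .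
  qed auto
  also have "\<dots> = (\<Sum>d=1..N. b d * T (N div d))"
    using sum_divisors_reorder[of "\<lambda>d e. b d * (\<chi> e / e)" N]
    by (simp only: T_def sum_distrib_left)
  also have "norm \<dots> \<le> (\<Sum>d=1..N. (1 * (1 / real d * ln (real N / real d))) * (2 * real m * (real d / real N)))"
  proof (rule sum_norm_le)
    fix d assume d: "d \<in> {1..N}"
    hence ln: "ln (real N / real d) \<ge> 0" by simp
    have "norm (T (N div d)) \<le> 2 * real m * (real d / real N)"
      using L_one_tail_div[of N d] d assms by (simp add: T_def)
    moreover have "norm (b d) \<le> 1 * (1 / real d * ln (real N / real d))"
      unfolding b_def norm_mult norm_of_real abs_mult abs_of_nonneg[OF ln]
      using abs_moebius_le_1[of d] ln
      by (intro mult_mono norm_le_1) (auto simp: divide_right_mono)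
    ultimately show "norm (b d * T (N div d))
        \<le> (1 * (1 / real d * ln (real N / real d))) * (2 * real m * (real d / real N))"
      unfolding norm_mult using ln by (intro mult_mono) auto
  qed
  also have "\<dots> = 2 * real m / real N * (\<Sum>d=1..N. ln (real N / real d))"
    unfolding sum_distrib_left by (intro sum.cong) auto
  also have "(\<Sum>d=1..N. ln (real N / real d)) = (\<Sum>d=1..N. ln (real N) - ln (real d))"
    using N by (intro sum.cong) (auto simp: ln_div)
  also have "\<dots> = N * ln N - (\<Sum>d=1..N. ln (real d))" by (simp add: sum_subtractf)
  also have "(\<Sum>d=1..N. ln (real d)) = ln (fact N)" by (induction N) (simp_all add: ln_mult)
  also have "2 * real m / real N * (N * ln N - ln (fact N)) \<le> 2 * real m / real N * real N"
    using ln_fact_bounds(2)[of N] by (intro mult_left_mono) auto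
  also have "\<dots> = 2 * real m" using N by simp
  finally show ?thesis .
qed

end

section \<open>Real characters\<close>

lemma sum_divisors_coprime_mult:
  fixes f :: "nat \<Rightarrow> real"
  assumes "coprime a b" and "\<And>x y. f (x * y) = f x * f y"
  shows "(\<Sum>d | d dvd a * b. f d) = (\<Sum>d | d dvd a. f d) * (\<Sum>d | d dvd b. f d)"
proof -
  have "bij_betw (\<lambda>(x, y). x * y) ({x. x dvd a} \<times> {y. y dvd b}) {d. d dvd a * b}"
    unfolding bij_betw_def
  proof (intro conjI equalityI subsetI)
    show "inj_on (\<lambda>(x, y). x * y) ({x. x dvd a} \<times> {y. y dvd b})"
    proof (rule inj_onI, clarify)
      fix x y x' y' assume *: "x dvd a" "y dvd b" "x' dvd a" "y' dvd b" "x * y = x' * y'"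
      have cop: "coprime u v" if "u dvd a" "v dvd b" for u v
        using assms(1) that by (meson coprime_divisors)
      have "x dvd x'" "x' dvd x" "y dvd y'" "y' dvd y"
        using * cop by (metis coprime_dvd_mult_left_iff coprime_dvd_mult_right_iff coprime_commute dvd_triv_left dvd_triv_right)+
      thus "x = x' \<and> y = y'" by (simp add: dvd_antisym)
    qed
  next
    fix d assume "d \<in> {d. d dvd a * b}"
    then obtain x y where "d = x * y" "x dvd a" "y dvd b" using division_decomp[of d a b] by auto
    thus "d \<in> (\<lambda>(x, y). x * y) ` ({x. x dvd a} \<times> {y. y dvd b})" by force
  qed (auto intro: mult_dvd_mono)
  hence "(\<Sum>d | d dvd a * b. f d) = (\<Sum>(x, y)\<in>{x. x dvd a} \<times> {y. y dvd b}. f (x * y))"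
    by (simp add: sum.reindex_bij_betw[symmetric] case_prod_unfold)
  also have "\<dots> = (\<Sum>d | d dvd a. f d) * (\<Sum>d | d dvd b. f d)"
    by (simp add: assms(2) sum_product sum.cartesian_product case_prod_unfold)
  finally show ?thesis .
qed

lemma sum_divisors_prime_power:
  fixes f :: "nat \<Rightarrow> real"
  assumes "prime p"
  shows "(\<Sum>d | d dvd p ^ k. f d) = (\<Sum>j\<le>k. f (p ^ j))"
proof -
  have "{d. d dvd p ^ k} = (\<lambda>j. p ^ j) ` {..k}"
    using assms by (auto simp: divides_primepow_nat le_imp_power_dvd)
  moreover have "inj_on (\<lambda>j. p ^ j) {..k}"
    using prime_gt_1_nat[OF assms] by (intro inj_onI) (simp add: power_inject_exp)
  ultimately show ?thesis by (simp add: sum.reindex)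
qed

lemma sum_powers_sign_nonneg:
  fixes x :: real
  assumes "x \<in> {-1, 0, 1}"
  shows "(\<Sum>j\<le>k. x ^ j) \<ge> 0" and "(\<Sum>j\<le>2 * k. x ^ j) \<ge> 1"
proof -
  have minus: "(\<Sum>j\<le>k. (-1) ^ j :: real) = (if even k then 1 else 0)" for k
    by (induction k) auto
  have null: "(\<Sum>j\<le>k. 0 ^ j :: real) = 1" for k
    by (induction k) auto
  show "(\<Sum>j\<le>k. x ^ j) \<ge> 0" "(\<Sum>j\<le>2 * k. x ^ j) \<ge> 1"
    using assms minus null by auto
qed

text \<open>
  The divisor sum is multiplicative, and at \<open>p ^ k\<close> it is \<open>\<Sum>j\<le>k. r p ^ j\<close>, which is nonnegative for each
  of the three values of \<open>r p\<close>, and positive if \<open>k\<close> is even.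
\<close>
lemma sum_divisors_sign_nonneg:
  fixes r :: "nat \<Rightarrow> real"
  assumes r: "\<And>n. r n \<in> {-1, 0, 1}" "r 1 = 1" and mult: "\<And>x y. r (x * y) = r x * r y" and "n > 0"
  shows "(\<Sum>d | d dvd n. r d) \<ge> 0 \<and> (\<Sum>d | d dvd n ^ 2. r d) \<ge> 1"
  using \<open>n > 0\<close>
proof (induction n rule: less_induct)
  case (less n)
  have rpow: "r (p ^ j) = r p ^ j" for p j
    using r(2) by (induction j) (simp_all add: mult)
  show ?case
  proof (cases "n = 1")
    case False
    then obtain p where p: "prime p" "p dvd n" by (metis prime_factor_nat)
    obtain b where b: "n = p ^ multiplicity p n * b" "\<not> p dvd b"
      using less.prems p(1) by (metis multiplicity_decompose' not_prime_unit less_irrefl)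
    define k where "k = multiplicity p n"
    have k: "k > 0" using p less.prems by (simp add: k_def prime_multiplicity_gt_zero_iff)
    have n: "n = p ^ k * b" using b by (simp add: k_def)
    have "b > 0" using less.prems by (auto simp: n intro!: Nat.gr0I)
    have "p ^ k > 1" using one_less_power[OF prime_gt_1_nat[OF p(1)] k] .
    with \<open>b > 0\<close> have "b < n" by (simp add: n)
    note IH = less.IH[OF \<open>b < n\<close> \<open>b > 0\<close>]
    have cop: "coprime (p ^ i) (b ^ j)" for i j
      using p(1) b(2) by (simp add: prime_imp_coprime)
    have "(\<Sum>d | d dvd n. r d) = (\<Sum>j\<le>k. r p ^ j) * (\<Sum>d | d dvd b. r d)"
      unfolding n using sum_divisors_coprime_mult[of "p ^ k" b r] cop[of k 1] mult
      by (simp add: sum_divisors_prime_power[OF p(1)] rpow)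
    hence "(\<Sum>d | d dvd n. r d) \<ge> 0"
      using IH sum_powers_sign_nonneg(1)[OF r(1)] by simp
    moreover have "(\<Sum>d | d dvd n ^ 2. r d) = (\<Sum>j\<le>2 * k. r p ^ j) * (\<Sum>d | d dvd b ^ 2. r d)"
      unfolding n using sum_divisors_coprime_mult[of "p ^ (2 * k)" "b ^ 2" r] cop[of "2 * k" 2] mult
      by (simp add: sum_divisors_prime_power[OF p(1)] rpow power_mult_distrib power_mult[symmetric] mult.commute[of 2])
    hence "(\<Sum>d | d dvd n ^ 2. r d) \<ge> 1"
      using mult_mono[OF sum_powers_sign_nonneg(2)[OF r(1), of p k] IH[THEN conjunct2]]
        sum_powers_sign_nonneg(1)[OF r(1), of p "2 * k"] by simp
    ultimately show ?thesis by blast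
  next
    case True
    have "(\<Sum>d | d dvd 1. r d) = 1" using r(2) by simp
    with True show ?thesis by simp
  qed
qed

text \<open>
  The inequality of arithmetic and geometric means, applied to each pair of terms at equal distance
  from the two ends.
\<close>
lemma geometric_sum_ge:
  fixes y :: real
  assumes "y \<ge> 0"
  shows "(\<Sum>i<n. (y\<^sup>2) ^ i) \<ge> n * y ^ (n - 1)"
proof -
  have "(\<Sum>i<n. (y\<^sup>2) ^ i) = (\<Sum>i<n. (y\<^sup>2) ^ (n - Suc i))"
    by (rule sum.nat_diff_reindex [symmetric])
  hence "2 * (\<Sum>i<n. (y\<^sup>2) ^ i) = (\<Sum>i<n. (y\<^sup>2) ^ i + (y\<^sup>2) ^ (n - Suc i))"
    by (simp add: sum.distrib)
  also have "\<dots> \<ge> (\<Sum>i<n. 2 * y ^ (n - 1))"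
  proof (rule sum_mono)
    fix i assume "i \<in> {..<n}"
    hence "y ^ (n - 1) = y ^ i * y ^ (n - Suc i)" by (simp add: power_add[symmetric])
    moreover have "0 \<le> (y ^ i - y ^ (n - Suc i))\<^sup>2" by simp
    ultimately show "2 * y ^ (n - 1) \<le> (y\<^sup>2) ^ i + (y\<^sup>2) ^ (n - Suc i)"
      by (simp add: power2_diff power_mult[symmetric] mult.commute[of 2])
  qed
  finally show ?thesis by simp
qed

text \<open>
  The number \<open>b n\<close> is \<open>1 / (n * (1 - x)) - x ^ n / (1 - x ^ n)\<close>. With \<open>g n = (\<Sum>i<n. x ^ i)\<close>, the claim
  that \<open>b\<close> decreases amounts to \<open>n * (n + 1) * x ^ n \<le> g n * g (n + 1)\<close>, which \<open>geometric_sum_ge\<close> gives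
  for \<open>y = sqrt x\<close>.
\<close>
lemma lambert_coefficients:
  fixes x :: real
  assumes x: "0 < x" "x < 1"
  defines "b \<equiv> \<lambda>n::nat. (1 / n - x ^ n / (\<Sum>i<n. x ^ i)) / (1 - x)"
  assumes n: "n \<ge> 1"
  shows "b (Suc n) \<le> b n" and "b n \<ge> 0"
proof -
  define g where "g = (\<lambda>n. \<Sum>i<n. x ^ i)"
  have b_g: "b n = (1 / n - x ^ n / g n) / (1 - x)" for n by (simp add: b_def g_def)
  have g_ge: "g n \<ge> n * sqrt x ^ (n - 1)" for n
    using geometric_sum_ge[of "sqrt x" n] x by (simp add: g_def)
  have g_pos: "g n > 0" if "n \<ge> 1" for n
    unfolding g_def using x that by (intro sum_pos) (auto simp: lessThan_empty_iff)
  have g_Suc: "g (Suc n) = 1 + x * g n" for n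
    unfolding g_def sum.lessThan_Suc_shift by (simp add: sum_distrib_left)
  have "x ^ n = sqrt x ^ (2 * n)" using x by (simp add: power_mult)
  also have "\<dots> \<le> sqrt x ^ (n - 1 + n)" using x by (intro power_decreasing) auto
  finally have "real (n * Suc n) * x ^ n \<le> real (n * Suc n) * (sqrt x ^ (n - 1) * sqrt x ^ n)"
    unfolding power_add by (intro mult_left_mono) auto
  also have "\<dots> = (n * sqrt x ^ (n - 1)) * (Suc n * sqrt x ^ (Suc n - 1))" by (simp add: algebra_simps)
  also have "\<dots> \<le> g n * g (Suc n)"
    using x g_pos[OF n] by (intro mult_mono g_ge) auto
  finally have gg: "real (n * Suc n) * x ^ n \<le> g n * g (Suc n)" .
  have "x ^ n / g n - x ^ Suc n / g (Suc n) = x ^ n * (g (Suc n) - x * g n) / (g n * g (Suc n))"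
    using g_pos[of n] g_pos[of "Suc n"] n by (simp add: field_simps)
  also have "g (Suc n) - x * g n = 1" by (simp add: g_Suc)
  also have "x ^ n * 1 / (g n * g (Suc n)) \<le> 1 / real (n * Suc n)"
  proof -
    have "x ^ n * 1 / (g n * g (Suc n)) \<le> (g n * g (Suc n) / real (n * Suc n)) / (g n * g (Suc n))"
      using gg n g_pos[of n] g_pos[of "Suc n"]
      by (intro divide_right_mono) (simp_all add: pos_le_divide_eq mult.commute del: of_nat_mult of_nat_Suc)
    thus ?thesis using g_pos[of n] g_pos[of "Suc n"] n by simp
  qed
  also have "1 / real (n * Suc n) = 1 / n - 1 / Suc n" using n by (simp add: field_simps)
  finally show "b (Suc n) \<le> b n"
    unfolding b_g using x by (intro divide_right_mono) linarith+
  have "(\<Sum>i<n. x ^ n) \<le> g n" unfolding g_def using x by (intro sum_mono power_decreasing) auto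
  hence "n * x ^ n \<le> g n" by simp
  hence "x ^ n / g n \<le> 1 / n" using n g_pos[OF n] by (simp add: field_simps)
  thus "b n \<ge> 0" unfolding b_g using x by simp
qed

context nonprincipal_character
begin

text \<open>
  The sum on the left consists of the terms up to \<open>x ^ N\<close> in the power series expansion of the Lambert
  series \<open>\<Sum>d. \<chi> d * x ^ d / (1 - x ^ d)\<close>. Subtracting
  \<open>(\<Sum>d. \<chi> d / d) / (1 - x) = 0\<close> leaves \<open>- (\<Sum>d. \<chi> d * b d)\<close> with the decreasing coefficients of
  \<open>lambert_coefficients\<close>, so the bound \<open>2 * m\<close> is uniform in \<open>x\<close>. The two remaining terms come from
  truncating at \<open>N\<close> and vanish as \<open>N\<close> grows.
\<close>
lemma lambert_sum_le:
  assumes "L_one \<chi> = 0" and x: "0 < x" "x < 1"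
  shows "norm (\<Sum>n=1..N. (\<Sum>d | d dvd n. \<chi> d) * of_real (x ^ n))
           \<le> 2 * real m + 2 * real m / (real N + 1) / (1 - x) + N * x ^ N / (1 - x)"
proof -
  define b where "b = (\<lambda>n::nat. (1 / n - x ^ n / (\<Sum>i<n. x ^ i)) / (1 - x))"
  have geo: "(\<Sum>i<n. x ^ i) = (1 - x ^ n) / (1 - x)" for n
    using x by (subst sum_gp_strict) auto
  have pow_less: "x ^ d < 1" if "d \<ge> 1" for d
    using x that by (intro power_less_one_iff[THEN iffD2]) auto
  have pow_le: "x ^ d \<le> x" if "d \<ge> 1" for d
    using power_decreasing[of 1 d x] that x by simp
  have inner: "(\<Sum>e=1..M. x ^ (d * e)) = 1 / (real d * (1 - x)) - b d - x ^ (d * Suc M) / (1 - x ^ d)"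
    if d: "d \<ge> 1" for d M
  proof -
    have "(\<Sum>e=1..M. x ^ (d * e)) = (x ^ d - x ^ (d * Suc M)) / (1 - x ^ d)"
    proof -
      have "(1 - x ^ d) * (\<Sum>e=1..M. x ^ (d * e)) = x ^ d - x ^ (d * Suc M)"
      proof (induction M)
        case (Suc M)
        have "x ^ (d * Suc (Suc M)) = x ^ d * x ^ (d * Suc M)" by (simp add: power_add)
        moreover have "(\<Sum>e=1..Suc M. x ^ (d * e)) = (\<Sum>e=1..M. x ^ (d * e)) + x ^ (d * Suc M)" by simp
        ultimately show ?case using Suc.IH by (simp only: distrib_left left_diff_distrib)
      qed simp
      thus ?thesis using pow_less[OF d] by (simp add: field_simps)
    qed
    also have "x ^ d / (1 - x ^ d) = 1 / (real d * (1 - x)) - b d"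
    proof -
      have "v / w = 1 / (real d * c) - (1 / real d - v / (w / c)) / c" if "w > 0" "c > 0" for v w c :: real
        using that d by (simp add: field_simps)
      from this[of "1 - x ^ d" "1 - x" "x ^ d"] show ?thesis
        unfolding b_def geo using x pow_less[OF d] by simp
    qed
    hence "(x ^ d - x ^ (d * Suc M)) / (1 - x ^ d) = 1 / (real d * (1 - x)) - b d - x ^ (d * Suc M) / (1 - x ^ d)"
      by (simp add: diff_divide_distrib)
    finally show ?thesis .
  qed
  have "(\<Sum>n=1..N. (\<Sum>d | d dvd n. \<chi> d) * of_real (x ^ n))
      = (\<Sum>n=1..N. \<Sum>d | d dvd n. \<chi> d * of_real (x ^ (d * (n div d))))"
    by (intro sum.cong) (auto simp: sum_distrib_right)
  also have "\<dots> = (\<Sum>d=1..N. \<Sum>e=1..N div d. \<chi> d * of_real (x ^ (d * e)))"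
    by (rule sum_divisors_reorder)
  also have "\<dots> = (\<Sum>d=1..N. \<chi> d * of_real (\<Sum>e=1..N div d. x ^ (d * e)))"
    by (simp only: of_real_sum sum_distrib_left)
  also have "\<dots> = (\<Sum>d=1..N. \<chi> d * of_real (1 / (real d * (1 - x)) - b d - x ^ (d * Suc (N div d)) / (1 - x ^ d)))"
    by (intro sum.cong refl) (subst inner, auto)
  also have "\<dots> = (\<Sum>d=1..N. \<chi> d / d) / (1 - x) - (\<Sum>d=1..N. \<chi> d * of_real (b d))
      - (\<Sum>d=1..N. \<chi> d * of_real (x ^ (d * Suc (N div d)) / (1 - x ^ d)))"
    by (simp only: of_real_diff right_diff_distrib sum_subtractf) (simp add: sum_divide_distrib right_diff_distrib)
  also have "norm \<dots> \<le> norm ((\<Sum>d=1..N. \<chi> d / d) / (1 - x)) + norm (\<Sum>d=1..N. \<chi> d * of_real (b d))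
      + norm (\<Sum>d=1..N. \<chi> d * of_real (x ^ (d * Suc (N div d)) / (1 - x ^ d)))"
    by (intro order.trans[OF norm_triangle_ineq4] add_mono order_refl)
  also have "norm ((\<Sum>d=1..N. \<chi> d / d) / (1 - x)) = norm (\<Sum>d=1..N. \<chi> d / d) / (1 - x)"
  proof -
    have "norm (complex_of_real (1 - x)) = 1 - x" unfolding norm_of_real using x by simp
    thus ?thesis by (simp add: norm_divide)
  qed
  also have "norm (\<Sum>d=1..N. \<chi> d / d) \<le> 2 * real m / (real N + 1)"
    using L_one_tail[of N] assms(1) by simp
  also have "norm (\<Sum>d=1..N. \<chi> d * of_real (b d)) \<le> 2 * real m"
  proof -
    have "norm (\<Sum>d=1..<Suc N. \<chi> d * of_real (b d)) \<le> 2 * real m * b 1"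
      using lambert_coefficients[OF x] norm_sum_le
      by (intro norm_sum_decreasing_le) (auto simp: b_def)
    also have "b 1 = 1" using x by (simp add: b_def)
    finally show ?thesis by (simp add: atLeastLessThanSuc_atLeastAtMost)
  qed
  also have "norm (\<Sum>d=1..N. \<chi> d * of_real (x ^ (d * Suc (N div d)) / (1 - x ^ d)))
      \<le> (\<Sum>d=1..N. 1 * (x ^ N / (1 - x)))"
  proof (rule sum_norm_le)
    fix d assume "d \<in> {1..N}"
    hence d: "d \<ge> 1" by simp
    have "N mod d \<le> d" using d by (simp add: order.strict_implies_order)
    moreover have "N = d * (N div d) + N mod d" by simp
    ultimately have "N \<le> d * Suc (N div d)" unfolding mult_Suc_right by linarith
    hence "x ^ (d * Suc (N div d)) \<le> x ^ N" using x by (intro power_decreasing) auto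
    hence "x ^ (d * Suc (N div d)) / (1 - x ^ d) \<le> x ^ N / (1 - x)"
      using x pow_le[OF d] by (intro frac_le) auto
    moreover have "x ^ (d * Suc (N div d)) / (1 - x ^ d) \<ge> 0"
      using x pow_less[OF d] by (intro divide_nonneg_nonneg) auto
    ultimately show "norm (\<chi> d * of_real (x ^ (d * Suc (N div d)) / (1 - x ^ d))) \<le> 1 * (x ^ N / (1 - x))"
      unfolding norm_mult norm_of_real by (intro mult_mono norm_le_1) (simp_all only: abs_of_nonneg abs_ge_zero)
  qed
  finally show ?thesis using x by (simp add: divide_right_mono)
qed

text \<open>
  If the value at \<open>1\<close> vanished, the power series with coefficients \<open>F n = (\<Sum>d | d dvd n. \<chi> d)\<close> would be
  bounded by \<open>2 * m\<close> on \<open>(0, 1)\<close>. But \<open>F\<close> is nonnegative and at least \<open>1\<close> on squares, so close to \<open>1\<close> the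
  series exceeds any given number.
\<close>
lemma L_one_nonzero_if_real:
  assumes real: "\<And>n. \<chi> n \<in> \<real>"
  shows "L_one \<chi> \<noteq> 0"
proof
  assume L0: "L_one \<chi> = 0"
  define r where "r = (\<lambda>n. Re (\<chi> n))"
  have \<chi>_r: "\<chi> n = of_real (r n)" for n using real[of n] by (simp add: r_def)
  have r_mult: "r (a * b) = r a * r b" for a b
    using mult[of a b] by (simp add: \<chi>_r flip: of_real_mult)
  have r_vals: "r n \<in> {-1, 0, 1}" for n
  proof (cases "coprime n m")
    case True
    have "\<bar>r n\<bar> = 1"
      using power_eq_1_iff[OF power_totient[OF True]] totient_modulus_pos by (simp add: \<chi>_r)
    thus ?thesis by auto
  next
    case False
    hence "\<chi> n = 0" by (simp add: eq_0_iff)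
    thus ?thesis by (simp add: r_def)
  qed
  have r_1: "r 1 = 1" by (simp add: r_def)
  define F where "F = (\<lambda>n. \<Sum>d | d dvd n. r d)"
  have F: "F n \<ge> 0" "F (n\<^sup>2) \<ge> 1" if "n > 0" for n
    using sum_divisors_sign_nonneg[of r n, OF r_vals r_1 r_mult that] by (simp_all add: F_def)
  have bound: "(\<Sum>k=1..K. x ^ k\<^sup>2) \<le> 2 * real m" if x: "0 < x" "x < 1" for x :: real and K :: nat
  proof (rule LIMSEQ_le_const)
    have "(\<lambda>N. 2 * real m + 2 * real m / (real N + 1) / (1 - x) + N * x ^ N / (1 - x))
        \<longlonglongrightarrow> 2 * real m + 0 / (1 - x) + 0 / (1 - x)"
    proof (intro tendsto_intros)
      show "(\<lambda>N. 2 * real m / (real N + 1)) \<longlonglongrightarrow> 0"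
        using tendsto_mult_right_zero[OF LIMSEQ_inverse_real_of_nat, of "2 * real m"] by (simp add: field_simps)
      show "(\<lambda>N. N * x ^ N) \<longlonglongrightarrow> 0" using x by (intro powser_times_n_limit_0) auto
    qed (use x in auto)
    thus "(\<lambda>N. 2 * real m + 2 * real m / (real N + 1) / (1 - x) + N * x ^ N / (1 - x)) \<longlonglongrightarrow> 2 * real m"
      by simp
    have "(\<Sum>k=1..K. x ^ k\<^sup>2) \<le> 2 * real m + 2 * real m / (real N + 1) / (1 - x) + N * x ^ N / (1 - x)"
      if N: "N \<ge> K\<^sup>2" for N
    proof -
      have "(\<Sum>k=1..K. x ^ k\<^sup>2) \<le> (\<Sum>k=1..K. F (k\<^sup>2) * x ^ k\<^sup>2)"
        using F(2) x by (intro sum_mono) auto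
      also have "\<dots> = (\<Sum>n\<in>(\<lambda>k. k\<^sup>2) ` {1..K}. F n * x ^ n)"
        by (subst sum.reindex) (auto simp: inj_on_def)
      also have "\<dots> \<le> (\<Sum>n=1..N. F n * x ^ n)"
      proof (rule sum_mono2)
        show "(\<lambda>k. k\<^sup>2) ` {1..K} \<subseteq> {1..N}"
          using N by (auto intro: order.trans[OF power_mono[of _ K 2]])
      qed (use F(1) x in auto)
      also have "\<dots> \<le> norm (complex_of_real (\<Sum>n=1..N. F n * x ^ n))"
        by (simp only: norm_of_real abs_ge_self)
      also have "complex_of_real (\<Sum>n=1..N. F n * x ^ n) = (\<Sum>n=1..N. (\<Sum>d | d dvd n. \<chi> d) * of_real (x ^ n))"
        by (simp add: F_def \<chi>_r)
      finally show ?thesis using lambert_sum_le[OF L0 x, of N] by linarith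
    qed
    thus "\<exists>M. \<forall>N\<ge>M. (\<Sum>k=1..K. x ^ k\<^sup>2) \<le> 2 * real m + 2 * real m / (real N + 1) / (1 - x) + N * x ^ N / (1 - x)"
      by blast
  qed
  \<comment> \<open>For \<open>x = 1 - \<delta>\<close> the first \<open>K\<close> squares contribute at least \<open>1 / 2\<close> each, in total \<open>2 * m + 1\<close>.\<close>
  define K where "K = 4 * m + 2"
  define \<delta> where "\<delta> = 1 / (2 * real K ^ 2)"
  have K: "real K ^ 2 \<ge> 1" by (simp add: K_def one_le_power)
  have "K > 0" by (simp add: K_def)
  moreover have "2 * real K ^ 2 > 1" using K by linarith
  ultimately have \<delta>: "\<delta> > 0" "\<delta> < 1" "real K ^ 2 * \<delta> = 1 / 2"
    unfolding \<delta>_def by simp_all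
  have "(\<Sum>k=1..K. 1 / 2) \<le> (\<Sum>k=1..K. (1 - \<delta>) ^ k\<^sup>2)"
  proof (rule sum_mono)
    fix k assume k: "k \<in> {1..K}"
    have "1 / 2 = 1 - real K ^ 2 * \<delta>" using \<delta> by simp
    also have "\<dots> \<le> 1 + real (k\<^sup>2) * (- \<delta>)"
      using k \<delta> by (simp add: power_mono)
    also have "\<dots> \<le> (1 + (- \<delta>)) ^ k\<^sup>2" using \<delta> by (intro Bernoulli_inequality) auto
    finally show "1 / 2 \<le> (1 - \<delta>) ^ k\<^sup>2" by simp
  qed
  also have "\<dots> \<le> 2 * real m" using \<delta> by (intro bound) auto
  finally show False by (simp add: K_def)
qed

end

section \<open>The group of characters and orthogonality\<close>

definition dirichlet_characters :: "nat \<Rightarrow> (nat \<Rightarrow> complex) set" where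
  "dirichlet_characters m = {\<chi>. dirichlet_character m \<chi>}"

definition principal_character :: "nat \<Rightarrow> nat \<Rightarrow> complex" where
  "principal_character m n = of_bool (coprime n m)"

lemma principal_in_dirichlet_characters:
  assumes "m > 1"
  shows "principal_character m \<in> dirichlet_characters m"
proof -
  have "coprime (n + m) m \<longleftrightarrow> coprime n m" for n
    by (simp only: coprime_iff_gcd_eq_1 gcd_add1)
  thus ?thesis using assms
    by (simp add: dirichlet_characters_def principal_character_def dirichlet_character_def)
qed

lemma nonprincipal_characterI:
  assumes "\<chi> \<in> dirichlet_characters m" "\<chi> \<noteq> principal_character m"
  shows "nonprincipal_character m \<chi>"
proof -
  interpret dirichlet_character m \<chi> using assms(1) by (simp add: dirichlet_characters_def)
  obtain n where n: "\<chi> n \<noteq> principal_character m n" using assms(2) by blast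
  hence "coprime n m \<and> \<chi> n \<noteq> 1"
    using eq_0_iff[of n] by (auto simp: principal_character_def split: if_splits)
  thus ?thesis by unfold_locales blast
qed

lemma times_in_dirichlet_characters:
  assumes "\<chi> \<in> dirichlet_characters m" "\<psi> \<in> dirichlet_characters m"
  shows "(\<lambda>n. \<chi> n * \<psi> n) \<in> dirichlet_characters m"
  using assms by (auto simp: dirichlet_characters_def dirichlet_character_def)

lemma cnj_in_dirichlet_characters:
  assumes "\<chi> \<in> dirichlet_characters m"
  shows "(\<lambda>n. cnj (\<chi> n)) \<in> dirichlet_characters m"
  using assms by (auto simp: dirichlet_characters_def dirichlet_character_def)

text \<open>
  A character is determined by its values on \<open>{..<m}\<close>, which are \<open>0\<close> or roots of unity of order
  dividing \<open>totient m\<close>.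
\<close>
lemma finite_dirichlet_characters:
  assumes "m > 1"
  shows "finite (dirichlet_characters m)"
proof (rule finite_subset)
  define R where "R = insert 0 {z :: complex. z ^ totient m = 1}"
  show "finite ((\<lambda>f n. f (n mod m)) ` ({..<m} \<rightarrow>\<^sub>E R))"
    using assms unfolding R_def by (intro finite_imageI finite_PiE finite.insertI finite_roots_unity) (auto simp: Suc_le_eq)
  show "dirichlet_characters m \<subseteq> (\<lambda>f n. f (n mod m)) ` ({..<m} \<rightarrow>\<^sub>E R)"
  proof
    fix \<chi> assume "\<chi> \<in> dirichlet_characters m"
    then interpret dirichlet_character m \<chi> by (simp add: dirichlet_characters_def)
    have "\<chi> n \<in> R" for n
      using eq_0_iff[of n] power_totient[of n] by (auto simp: R_def)
    moreover have "\<chi> = (\<lambda>n. restrict \<chi> {..<m} (n mod m))"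
      using modulus_gt_1 by (simp add: mod_eq)
    ultimately show "\<chi> \<in> (\<lambda>f n. f (n mod m)) ` ({..<m} \<rightarrow>\<^sub>E R)"
      by (intro image_eqI[of _ _ "restrict \<chi> {..<m}"]) auto
  qed
qed

text \<open>
  A primitive root \<open>g\<close> modulo \<open>q\<close> makes the discrete logarithm a homomorphism to the integers modulo
  \<open>totient q\<close>; composing it with \<open>i \<mapsto> cis (2 * pi * i / totient q)\<close> gives a faithful character
  of the units modulo \<open>q\<close>, here restricted to the numbers prime to \<open>m\<close>.
\<close>
lemma exists_character_of_primroot:
  assumes q: "q > 1" "residue_primroot q g" "q dvd m" "m > 1"
    and a: "coprime a m" "\<not> [a = 1] (mod q)"
  shows "\<exists>\<psi>\<in>dirichlet_characters m. \<psi> a \<noteq> 1"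
proof -
  define t where "t = totient q"
  have t: "t > 0" using q(1) by (simp add: t_def)
  have ord: "ord q g = t" and cop_g: "coprime q g" using q(2) by (auto simp: residue_primroot_def t_def)
  have "\<exists>i. i < t \<and> [g ^ i = n] (mod q)" if "coprime n m" for n
  proof -
    have "coprime n q" using that q(3) by (meson coprime_divisors dvd_refl)
    moreover have "n mod q \<noteq> 0"
    proof
      assume "n mod q = 0"
      with \<open>coprime n q\<close> q(1) show False by (metis coprime_0_left_iff coprime_mod_left_iff nat_dvd_1_iff_1 less_irrefl nat_neq_iff not_less_zero)
    qed
    ultimately have "n mod q \<in> totatives q" using q(1) by (simp add: totatives_def order.strict_implies_order)
    with residue_primroot_is_generator[OF q(1,2)] obtain i where "i < t" "g ^ i mod q = n mod q"
      unfolding t_def bij_betw_def by (metis (mono_tags, lifting) imageE lessThan_iff)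
    thus ?thesis by (auto simp: cong_def)
  qed
  then obtain ind where ind: "coprime n m \<Longrightarrow> ind n < t \<and> [g ^ ind n = n] (mod q)" for n by metis
  define w where "w = (\<lambda>i::nat. cis (2 * pi * real i / real t))"
  have w_bij: "inj_on w {..<t}" using bij_betw_roots_unity[OF t] by (simp add: w_def bij_betw_def)
  have w_add: "w (i + j) = w i * w j" for i j
    by (simp add: w_def cis_mult add_divide_distrib ring_distribs)
  have w_t: "w (k * t) = 1" for k
  proof -
    have "2 * pi * real (k * t) / real t = 2 * pi * real k" using t by simp
    thus ?thesis unfolding w_def by (simp only:) (rule cis_multiple_2pi, simp)
  qed
  have w_mod: "w (i mod t) = w i" for i
    using w_add[of "i mod t" "i div t * t"] by (simp add: w_t)
  have w_cong: "w i = w j" if "[i = j] (mod t)" for i j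
    using that w_mod by (metis cong_def)
  have ind_cong: "w (ind b) = w i" if "coprime b m" "[g ^ i = b] (mod q)" for i b
  proof (rule w_cong)
    have "[g ^ ind b = g ^ i] (mod q)" using ind[OF that(1)] that(2) by (metis cong_sym cong_trans)
    thus "[ind b = i] (mod t)" using order_divides_expdiff[OF cop_g] ord by simp
  qed
  define \<psi> where "\<psi> = (\<lambda>n. if coprime n m then w (ind n) else 0)"
  have "\<psi> \<in> dirichlet_characters m"
    unfolding dirichlet_characters_def mem_Collect_eq
  proof
    fix b c
    show "\<psi> (b * c) = \<psi> b * \<psi> c"
    proof (cases "coprime b m \<and> coprime c m")
      case True
      have "[g ^ (ind b + ind c) = b * c] (mod q)"
        unfolding power_add using ind True by (intro cong_mult) auto
      thus ?thesis using True by (simp add: \<psi>_def ind_cong w_add)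
    qed (auto simp: \<psi>_def)
    have cop: "coprime (b + m) m \<longleftrightarrow> coprime b m"
      by (simp only: coprime_iff_gcd_eq_1 gcd_add1)
    show "\<psi> (b + m) = \<psi> b"
    proof (cases "coprime b m")
      case True
      have "[b + m = b] (mod q)" using q(3) by (auto simp: cong_def elim!: dvdE)
      hence "[g ^ ind b = b + m] (mod q)" using ind[OF True] by (metis cong_sym cong_trans)
      thus ?thesis using True cop by (simp add: \<psi>_def ind_cong)
    qed (simp add: \<psi>_def cop)
    show "\<psi> b = 0 \<longleftrightarrow> \<not> coprime b m" by (simp add: \<psi>_def w_def)
  qed (fact q(4))
  moreover have "\<psi> a \<noteq> 1"
  proof
    assume "\<psi> a = 1"
    hence "w (ind a) = w 0" using a(1) by (simp add: \<psi>_def w_def)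
    hence "ind a = 0" using w_bij ind[OF a(1)] t by (auto simp: inj_on_def)
    thus False using ind[OF a(1)] a(2) by (auto simp: cong_sym_eq)
  qed
  ultimately show ?thesis by blast
qed

text \<open>
  If \<open>a\<close> is not \<open>1\<close> modulo \<open>m\<close>, then it is not \<open>1\<close> modulo some prime power \<open>q\<close> that exactly divides \<open>m\<close>.
  Odd prime powers have primitive roots; powers of \<open>2\<close> in general do not, whence the restriction to odd
  moduli.
\<close>
lemma exists_separating_character:
  assumes m: "odd m" "m > 1" and a: "coprime a m" "\<not> [a = 1] (mod m)"
  shows "\<exists>\<psi>\<in>dirichlet_characters m. \<psi> a \<noteq> 1"
proof -
  have "a \<noteq> 0"
  proof
    assume "a = 0"
    thus False using a(1) m(2) by simp
  qed
  hence not_dvd: "\<not> m dvd a - 1" using a(2) by (metis One_nat_def Suc_leI cong_altdef_nat neq0_conv)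
  hence "a - 1 \<noteq> 0" by auto
  obtain p where p: "prime p" "multiplicity p (a - 1) < multiplicity p m"
    using multiplicity_le_imp_dvd[of m "a - 1"] not_dvd m(2) by (metis gr_implies_not0 not_le)
  define q where "q = p ^ multiplicity p m"
  have q_dvd: "q dvd m" by (simp add: q_def multiplicity_dvd)
  have "multiplicity p m > 0" using p(2) by simp
  moreover have "odd p"
  proof -
    have "p dvd m" using \<open>multiplicity p m > 0\<close> by (metis not_dvd_imp_multiplicity_0 less_irrefl)
    thus ?thesis using m(1) by auto
  qed
  ultimately obtain g where "residue_primroot q g"
    using residue_primroot_odd_prime_power_exists[OF p(1)] unfolding q_def by metis
  moreover have "q > 1"
    unfolding q_def using one_less_power[OF prime_gt_1_nat[OF p(1)] \<open>multiplicity p m > 0\<close>] .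
  moreover have "\<not> [a = 1] (mod q)"
  proof
    assume "[a = 1] (mod q)"
    hence "q dvd a - 1" using \<open>a \<noteq> 0\<close> by (metis One_nat_def Suc_leI cong_altdef_nat neq0_conv)
    hence "multiplicity p m \<le> multiplicity p (a - 1)"
      unfolding q_def using p(1) \<open>a - 1 \<noteq> 0\<close>
      by (subst (asm) power_dvd_iff_le_multiplicity) auto
    thus False using p(2) by simp
  qed
  ultimately show ?thesis using exists_character_of_primroot[OF _ _ q_dvd m(2) a(1)] by blast
qed

text \<open>
  If \<open>\<psi>\<close> separates \<open>a\<close> from \<open>1\<close>, multiplication by \<open>\<psi>\<close> permutes the characters and multiplies the sum
  by \<open>\<psi> a \<noteq> 1\<close>.
\<close>
lemma sum_dirichlet_characters:
  assumes m: "odd m" "m > 1"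
  shows "(\<Sum>\<chi>\<in>dirichlet_characters m. \<chi> a)
       = (if [a = 1] (mod m) then of_nat (card (dirichlet_characters m)) else 0)"
proof -
  let ?X = "dirichlet_characters m"
  consider "[a = 1] (mod m)" | "\<not> coprime a m" "\<not> [a = 1] (mod m)" | "coprime a m" "\<not> [a = 1] (mod m)" by blast
  thus ?thesis
  proof cases
    case 1
    have "\<chi> a = 1" if "\<chi> \<in> ?X" for \<chi>
    proof -
      interpret dirichlet_character m \<chi> using that by (simp add: dirichlet_characters_def)
      show ?thesis using cong_eq[OF 1] one by (simp only: One_nat_def)
    qed
    hence "(\<Sum>\<chi>\<in>?X. \<chi> a) = (\<Sum>\<chi>\<in>?X. 1)" by (intro sum.cong) auto
    thus ?thesis using 1 by simp
  next
    case 2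
    have "\<chi> a = 0" if "\<chi> \<in> ?X" for \<chi>
      using that 2 by (auto simp: dirichlet_characters_def dirichlet_character_def)
    hence "(\<Sum>\<chi>\<in>?X. \<chi> a) = (\<Sum>\<chi>\<in>?X. 0)" by (intro sum.cong) auto
    thus ?thesis using 2 by simp
  next
    case 3
    obtain \<psi> where \<psi>: "\<psi> \<in> ?X" "\<psi> a \<noteq> 1" using exists_separating_character[OF m 3] by blast
    let ?T = "\<lambda>\<chi> n. \<psi> n * \<chi> n"
    have "inj_on ?T ?X"
    proof (intro inj_onI ext)
      fix \<chi> \<chi>' n assume *: "\<chi> \<in> ?X" "\<chi>' \<in> ?X" "?T \<chi> = ?T \<chi>'"
      have "\<psi> n * \<chi> n = \<psi> n * \<chi>' n" using fun_cong[OF *(3), of n] by simp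
      moreover have "\<psi> n = 0 \<longleftrightarrow> \<not> coprime n m" "\<chi> n = 0 \<longleftrightarrow> \<not> coprime n m" "\<chi>' n = 0 \<longleftrightarrow> \<not> coprime n m"
        using * \<psi>(1) by (auto simp: dirichlet_characters_def dirichlet_character_def)
      ultimately show "\<chi> n = \<chi>' n" by (metis mult_left_cancel)
    qed
    moreover have "?T ` ?X \<subseteq> ?X" using times_in_dirichlet_characters[OF \<psi>(1)] by blast
    ultimately have "bij_betw ?T ?X ?X"
      using finite_dirichlet_characters[OF m(2)] by (simp add: bij_betw_def endo_inj_surj)
    hence "(\<Sum>\<chi>\<in>?X. \<chi> a) = (\<Sum>\<chi>\<in>?X. ?T \<chi> a)"
      by (rule sum.reindex_bij_betw[symmetric])
    also have "\<dots> = \<psi> a * (\<Sum>\<chi>\<in>?X. \<chi> a)" by (simp add: sum_distrib_left)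
    finally show ?thesis using \<psi>(2) 3 by simp
  qed
qed

section \<open>Primes in residue classes of odd modulus\<close>

lemma sum_inverse_sqrt_cubed_le:
  assumes "N \<ge> 1"
  shows "(\<Sum>p=2..N. 1 / (real p * sqrt p)) \<le> 2 - 2 / sqrt N"
  using assms
proof (induction N rule: nat_induct_at_least)
  case (Suc N)
  define s where "s = sqrt (real N)"
  define t where "t = sqrt (real (Suc N))"
  have st: "s > 0" "s \<le> t" "t\<^sup>2 = s\<^sup>2 + 1" "t\<^sup>2 = real (Suc N)" using Suc.hyps by (auto simp: s_def t_def)
  hence "1 = (t - s) * (t + s)" by (simp add: algebra_simps power2_eq_square)
  also have "\<dots> \<le> (t - s) * (2 * t)" using st by (intro mult_left_mono) auto
  finally have "t \<le> (t - s) * (2 * t) * t"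
    using mult_right_mono[of 1 "(t - s) * (2 * t)" t] st by simp
  hence "s \<le> (t - s) * (2 * t) * t" using st by linarith
  hence "s \<le> 2 * (t - s) * t\<^sup>2" by (simp only: power2_eq_square mult_ac)
  hence "s / (s * (t\<^sup>2 * t)) \<le> 2 * (t - s) * t\<^sup>2 / (s * (t\<^sup>2 * t))"
    using st(1,2) by (intro divide_right_mono) auto
  also have "2 * (t - s) * t\<^sup>2 / (s * (t\<^sup>2 * t)) = 2 / s - 2 / t"
    using st(1,2) by (simp add: field_simps)
  finally have "1 / (t\<^sup>2 * t) \<le> 2 / s - 2 / t" using st(1,2) by simp
  hence "1 / (real (Suc N) * sqrt (real (Suc N))) \<le> 2 / sqrt (real N) - 2 / sqrt (real (Suc N))"
    unfolding st(4) unfolding s_def t_def .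
  thus ?case using Suc by simp
qed simp

lemma sum_Un_nonneg_le:
  fixes f :: "nat \<Rightarrow> real"
  assumes "finite A" "finite B" "\<And>x. f x \<ge> 0"
  shows "sum f (A \<union> B) \<le> sum f A + sum f B"
  using assms by (simp add: sum_Un sum_nonneg)

text \<open>
  Only the powers \<open>p ^ k\<close> with \<open>k \<ge> 2\<close> contribute. For fixed \<open>p\<close> they add up to at most \<open>2 * ln p / p\<^sup>2\<close>,
  and \<open>ln p \<le> 2 * sqrt p\<close> reduces the sum over \<open>p\<close> to \<open>sum_inverse_sqrt_cubed_le\<close>.
\<close>
lemma sum_mangoldt_nonprime_bounded:
  "(\<Sum>n\<in>{n\<in>{1..N}. \<not> prime n}. mangoldt n / n) \<le> (8 :: real)"
proof (cases "N \<ge> 1")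
  case N: True
  define P where "P = {p\<in>{2..N}. prime p}"
  define f where "f = (\<lambda>n. mangoldt n / real n)"
  have "(\<Sum>n\<in>{n\<in>{1..N}. \<not> prime n}. f n) = (\<Sum>n\<in>{n\<in>{1..N}. \<not> prime n \<and> primepow n}. f n)"
    by (intro sum.mono_neutral_right) (auto simp: f_def mangoldt_def)
  also have "\<dots> \<le> (\<Sum>n\<in>(\<lambda>(p,k). p ^ k) ` (P \<times> {2..N}). f n)"
  proof (rule sum_mono2)
    show "{n\<in>{1..N}. \<not> prime n \<and> primepow n} \<subseteq> (\<lambda>(p,k). p ^ k) ` (P \<times> {2..N})"
    proof safe
      fix n assume n: "n \<in> {1..N}" "\<not> prime n" "primepow n"
      then obtain p k where pk: "prime p" "k > 0" "n = p ^ k" by (auto simp: primepow_def)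
      have "k \<noteq> 1" using pk n(2) by auto
      hence "k \<ge> 2" using pk(2) by simp
      moreover have "k \<le> n" unfolding pk(3) using prime_gt_1_nat[OF pk(1)] by (intro less_imp_le power_gt_expt) simp
      moreover have "p \<le> n" unfolding pk(3) using prime_gt_1_nat[OF pk(1)] pk(2) by (intro self_le_power) auto
      ultimately have "k \<ge> 2" "k \<le> N" "p \<le> N" using n(1) by auto
      thus "n \<in> (\<lambda>(p,k). p ^ k) ` (P \<times> {2..N})"
        using pk n(1) prime_ge_2_nat[OF pk(1)] by (intro image_eqI[of _ _ "(p, k)"]) (auto simp: P_def)
    qed
  qed (auto simp: P_def f_def mangoldt_nonneg)
  also have "\<dots> \<le> (\<Sum>(p,k)\<in>P \<times> {2..N}. f (p ^ k))"
    using sum_image_le[of "P \<times> {2..N}" f "\<lambda>(p,k). p ^ k"]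
    by (simp add: P_def f_def mangoldt_nonneg case_prod_unfold o_def)
  also have "\<dots> = (\<Sum>p\<in>P. \<Sum>k=2..N. f (p ^ k))"
    by (rule sum.cartesian_product [symmetric])
  also have "\<dots> \<le> (\<Sum>p\<in>P. 4 * (1 / (real p * sqrt p)))"
  proof (rule sum_mono)
    fix p assume "p \<in> P"
    hence p: "prime p" "p \<ge> 2" by (auto simp: P_def)
    have x: "1 / real p \<le> 1 / 2" "0 < 1 / real p" using p(2) by (auto simp: field_simps)
    have geo: "(\<Sum>k=2..M. y ^ k) \<le> 2 * y\<^sup>2" if "0 < y" "y \<le> 1 / 2" for y :: real and M :: nat
    proof -
      have "(1 - y) * (\<Sum>k=2..M. y ^ k) \<le> y\<^sup>2"
        using that sum_gp_multiplied[of 2 M y] by (cases "M \<ge> 2") auto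
      moreover have "(1 / 2) * (\<Sum>k=2..M. y ^ k) \<le> (1 - y) * (\<Sum>k=2..M. y ^ k)"
        using that by (intro mult_right_mono sum_nonneg) auto
      ultimately show ?thesis by simp
    qed
    have "(\<Sum>k=2..N. f (p ^ k)) = ln p * (\<Sum>k=2..N. (1 / real p) ^ k)"
      unfolding sum_distrib_left f_def using p(1)
      by (intro sum.cong) (auto simp: mangoldt_primepow power_one_over)
    also have "\<dots> \<le> ln p * (2 * (1 / real p)\<^sup>2)"
      using p x by (intro mult_left_mono geo) auto
    also have "\<dots> \<le> 2 * sqrt p * (2 * (1 / real p)\<^sup>2)"
    proof (rule mult_right_mono)
      have "ln (real p) = 2 * ln (sqrt p)" using p(2) by (simp add: ln_sqrt)
      also have "\<dots> \<le> 2 * sqrt p" using ln_le_minus_one[of "sqrt p"] p(2) by simp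
      finally show "ln p \<le> 2 * sqrt p" .
    qed simp
    also have "2 * sqrt p * (2 * (1 / real p)\<^sup>2) = 4 * (1 / (real p * sqrt p))"
    proof -
      have "real p = sqrt p * sqrt p" by simp
      thus ?thesis using p(2) by (simp add: field_simps power2_eq_square)
    qed
    finally show "(\<Sum>k=2..N. f (p ^ k)) \<le> 4 * (1 / (real p * sqrt p))" by simp
  qed
  also have "\<dots> \<le> (\<Sum>p=2..N. 4 * (1 / (real p * sqrt p)))"
    by (rule sum_mono2) (auto simp: P_def)
  also have "\<dots> \<le> 4 * (2 - 2 / sqrt N)"
    unfolding sum_distrib_left[symmetric] by (intro mult_left_mono sum_inverse_sqrt_cubed_le N) simp
  also have "\<dots> \<le> 8" by simp
  finally show ?thesis by (simp add: f_def)
qed simp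

text \<open>
  The principal character omits the numbers not prime to \<open>m\<close>; among these, the primes are at most \<open>m\<close>,
  and the rest is covered by \<open>sum_mangoldt_nonprime_bounded\<close>.
\<close>
lemma principal_mangoldt_sum:
  assumes "m > 1"
  shows "\<exists>C. \<forall>N. norm (mangoldt_sum_upto (principal_character m) N - of_real (ln (real N))) \<le> C"
proof (intro exI allI)
  fix N
  let ?A = "{n\<in>{1..N}. coprime n m}" and ?B = "{n\<in>{1..N}. \<not> coprime n m}"
  let ?f = "\<lambda>n. mangoldt n / real n"
  define C where "C = (\<Sum>n=1..m. ?f n)"
  have f0: "?f n \<ge> 0" for n by (simp add: mangoldt_nonneg)
  have "mangoldt_sum_upto (principal_character m) N = (\<Sum>n=1..N. of_real (if coprime n m then ?f n else 0))"
    unfolding mangoldt_sum_upto_def principal_character_def by (intro sum.cong) auto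
  also have "\<dots> = of_real (\<Sum>n\<in>?A. ?f n)"
    unfolding of_real_sum[symmetric] by (subst sum.inter_filter) auto
  finally have S: "mangoldt_sum_upto (principal_character m) N = of_real (\<Sum>n\<in>?A. ?f n)" .
  have "(\<Sum>n=1..N. ?f n) = (\<Sum>n\<in>?A \<union> ?B. ?f n)" by (intro sum.cong) auto
  also have "\<dots> = (\<Sum>n\<in>?A. ?f n) + (\<Sum>n\<in>?B. ?f n)"
    by (rule sum.union_disjoint) auto
  finally have "(\<Sum>n=1..N. ?f n) = (\<Sum>n\<in>?A. ?f n) + (\<Sum>n\<in>?B. ?f n)" .
  moreover have "(\<Sum>n\<in>?B. ?f n) \<ge> 0" by (intro sum_nonneg f0)
  moreover have "(\<Sum>n\<in>?B. ?f n) \<le> 8 + C"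
  proof -
    have "?B \<subseteq> {n\<in>{1..N}. \<not> prime n} \<union> {1..m}"
    proof
      fix n assume n: "n \<in> ?B"
      show "n \<in> {n\<in>{1..N}. \<not> prime n} \<union> {1..m}"
      proof (cases "prime n")
        case True
        hence "n dvd m" using n by (auto dest: prime_imp_coprime)
        thus ?thesis using n assms by (auto dest: dvd_imp_le)
      qed (use n in auto)
    qed
    hence "(\<Sum>n\<in>?B. ?f n) \<le> (\<Sum>n\<in>{n\<in>{1..N}. \<not> prime n} \<union> {1..m}. ?f n)"
      by (intro sum_mono2 f0) auto
    also have "\<dots> \<le> (\<Sum>n\<in>{n\<in>{1..N}. \<not> prime n}. ?f n) + (\<Sum>n=1..m. ?f n)"
      by (intro sum_Un_nonneg_le) (auto simp: mangoldt_nonneg)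
    finally show ?thesis using sum_mangoldt_nonprime_bounded[of N] by (simp add: C_def)
  qed
  ultimately have "\<bar>(\<Sum>n\<in>?A. ?f n) - ln N\<bar> \<le> 13 + C" using mertens[of N] by linarith
  thus "norm (mangoldt_sum_upto (principal_character m) N - of_real (ln (real N))) \<le> 13 + C"
    unfolding S of_real_diff[symmetric] norm_of_real .
qed

lemma L_one_cnj: "nonprincipal_character m \<chi> \<Longrightarrow> L_one (\<lambda>n. cnj (\<chi> n)) = cnj (L_one \<chi>)"
proof -
  assume "nonprincipal_character m \<chi>"
  then interpret nonprincipal_character m \<chi> .
  have "(\<lambda>n. cnj (\<chi> n / n)) sums cnj (L_one \<chi>)"
    unfolding L_one_def sums_cnj using summable_over_n by (rule summable_sums)
  thus ?thesis by (simp add: L_one_def sums_iff)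
qed

lemma ln_multiple_bounded_below:
  assumes "\<And>N::nat. k * ln (real N) \<ge> - C"
  shows "k \<ge> 0"
proof (rule ccontr)
  assume "\<not> k \<ge> 0"
  obtain N :: nat where "real N > exp (\<bar>C\<bar> / (- k) + 1)" using reals_Archimedean2 by blast
  hence "ln (real N) > \<bar>C\<bar> / (- k) + 1" by (metis exp_gt_zero exp_less_cancel_iff exp_ln order.strict_trans)
  hence "(- k) * ln (real N) > (- k) * (\<bar>C\<bar> / (- k))"
    using \<open>\<not> k \<ge> 0\<close> by (intro mult_strict_left_mono) auto
  hence "- k * ln (real N) > C" using \<open>\<not> k \<ge> 0\<close> by auto
  with assms[of N] show False by simp
qed

text \<open>
  The coefficient of \<open>ln N\<close> in the asymptotics of \<open>mangoldt_sum_upto \<chi> N\<close>. For odd \<open>m\<close> the value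
  \<open>-1\<close> turns out not to occur (\<open>L_one_nonzero\<close>), but the proof of that weighs the characters with this
  slope against the principal one.
\<close>
definition mangoldt_sum_slope :: "nat \<Rightarrow> (nat \<Rightarrow> complex) \<Rightarrow> complex" where
  "mangoldt_sum_slope m \<chi> =
     (if \<chi> = principal_character m then 1 else if L_one \<chi> = 0 then -1 else 0)"

text \<open>
  Summing \<open>\<chi> b * mangoldt_sum_upto \<chi> N\<close> over all characters selects, by orthogonality, the \<open>n\<close> that are
  inverse to \<open>b\<close>. The case \<open>b = 1\<close> is used to show that no value at \<open>1\<close> vanishes, the general case
  for the primes in a residue class.
\<close>
lemma character_sum_asymptotics:
  assumes m: "odd m" "m > 1"
  defines "X \<equiv> dirichlet_characters m"
  shows "\<exists>C. \<forall>N. norm (of_real (card X * (\<Sum>n\<in>{n\<in>{1..N}. [b * n = 1] (mod m)}. mangoldt n / n))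
                    - (\<Sum>\<chi>\<in>X. \<chi> b * mangoldt_sum_slope m \<chi>) * of_real (ln (real N))) \<le> C"
proof -
  have char: "dirichlet_character m \<chi>" if "\<chi> \<in> X" for \<chi> using that by (simp add: X_def dirichlet_characters_def)
  have "\<exists>C. \<forall>N. norm (mangoldt_sum_upto \<chi> N - mangoldt_sum_slope m \<chi> * of_real (ln (real N))) \<le> C" if "\<chi> \<in> X" for \<chi>
  proof (cases "\<chi> = principal_character m")
    case True
    thus ?thesis using principal_mangoldt_sum[OF m(2)] by (simp add: mangoldt_sum_slope_def)
  next
    case False
    then interpret nonprincipal_character m \<chi> using that unfolding X_def by (rule nonprincipal_characterI[rotated])
    show ?thesis
    proof (cases "L_one \<chi> = 0")
      case True
      thus ?thesis using mangoldt_sum_if_L_one_eq_0 False by (auto simp: mangoldt_sum_slope_def add.commute)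
    next
      case nz: False
      obtain C where "norm (L_one \<chi> * mangoldt_sum_upto \<chi> N) \<le> C" for N
        using L_one_times_mangoldt_sum_bounded by blast
      hence "norm (mangoldt_sum_upto \<chi> N) \<le> C / norm (L_one \<chi>)" for N
        using nz by (simp add: norm_mult field_simps)
      thus ?thesis using nz False by (auto simp: mangoldt_sum_slope_def)
    qed
  qed
  then obtain C where C: "norm (mangoldt_sum_upto \<chi> N - mangoldt_sum_slope m \<chi> * of_real (ln (real N))) \<le> C \<chi>" if "\<chi> \<in> X" for \<chi> N
    by metis
  have "norm (of_real (card X * (\<Sum>n\<in>{n\<in>{1..N}. [b * n = 1] (mod m)}. mangoldt n / n))
            - (\<Sum>\<chi>\<in>X. \<chi> b * mangoldt_sum_slope m \<chi>) * of_real (ln (real N))) \<le> (\<Sum>\<chi>\<in>X. C \<chi>)" for N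
  proof -
    have "(\<Sum>\<chi>\<in>X. \<chi> b * mangoldt_sum_upto \<chi> N) = (\<Sum>\<chi>\<in>X. \<Sum>n=1..N. \<chi> (b * n) * of_real (mangoldt n / n))"
      unfolding mangoldt_sum_upto_def sum_distrib_left
      by (intro sum.cong refl) (simp add: dirichlet_character.mult[OF char])
    also have "\<dots> = (\<Sum>n=1..N. (\<Sum>\<chi>\<in>X. \<chi> (b * n)) * of_real (mangoldt n / n))"
      unfolding sum_distrib_right by (rule sum.swap)
    also have "\<dots> = (\<Sum>n=1..N. of_real (if [b * n = 1] (mod m) then card X * (mangoldt n / n) else 0))"
      unfolding X_def sum_dirichlet_characters[OF m] by (intro sum.cong) auto
    also have "\<dots> = of_real (card X * (\<Sum>n\<in>{n\<in>{1..N}. [b * n = 1] (mod m)}. mangoldt n / n))"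
      unfolding of_real_sum[symmetric] sum_distrib_left by (subst sum.inter_filter) auto
    finally have eq: "of_real (card X * (\<Sum>n\<in>{n\<in>{1..N}. [b * n = 1] (mod m)}. mangoldt n / n))
          - (\<Sum>\<chi>\<in>X. \<chi> b * mangoldt_sum_slope m \<chi>) * of_real (ln (real N))
        = (\<Sum>\<chi>\<in>X. \<chi> b * (mangoldt_sum_upto \<chi> N - mangoldt_sum_slope m \<chi> * of_real (ln (real N))))"
      by (simp add: right_diff_distrib sum_subtractf sum_distrib_right mult.assoc)
    have "norm (\<Sum>\<chi>\<in>X. \<chi> b * (mangoldt_sum_upto \<chi> N - mangoldt_sum_slope m \<chi> * of_real (ln (real N)))) \<le> (\<Sum>\<chi>\<in>X. 1 * C \<chi>)"
    proof (rule sum_norm_le)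
      fix \<chi> assume "\<chi> \<in> X"
      thus "norm (\<chi> b * (mangoldt_sum_upto \<chi> N - mangoldt_sum_slope m \<chi> * of_real (ln (real N)))) \<le> 1 * C \<chi>"
        unfolding norm_mult using C dirichlet_character.norm_le_1[OF char]
        by (intro mult_mono) auto
    qed
    thus ?thesis unfolding eq by simp
  qed
  thus ?thesis by blast
qed

text \<open>
  Suppose the value at \<open>1\<close> vanishes for \<open>\<chi>\<close>. By \<open>L_one_nonzero_if_real\<close>, \<open>\<chi>\<close> is not real, so its
  conjugate is a second character with vanishing value. The slopes of all characters then add up to at most
  \<open>1 - 1 - 1\<close>, whereas \<open>character_sum_asymptotics\<close> for \<open>b = 1\<close> describes a sum of nonnegative terms.
\<close>
theorem L_one_nonzero:
  assumes m: "odd m" "m > 1" and \<chi>: "\<chi> \<in> dirichlet_characters m" "\<chi> \<noteq> principal_character m"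
  shows "L_one \<chi> \<noteq> 0"
proof
  assume L0: "L_one \<chi> = 0"
  define X where "X = dirichlet_characters m"
  let ?c = "mangoldt_sum_slope m"
  have fin: "finite X" unfolding X_def by (rule finite_dirichlet_characters[OF m(2)])
  interpret nonprincipal_character m \<chi> using \<chi> by (rule nonprincipal_characterI)
  define \<chi>' where "\<chi>' = (\<lambda>n. cnj (\<chi> n))"
  obtain n where "\<chi> n \<notin> \<real>" using L_one_nonzero_if_real L0 by blast
  hence "\<chi>' \<noteq> \<chi>" by (metis \<chi>'_def Reals_cnj_iff)
  have "\<chi>' \<noteq> principal_character m"
  proof
    assume "\<chi>' = principal_character m"
    hence "cnj (\<chi> n) = principal_character m n" for n by (metis \<chi>'_def)
    hence "\<chi> n = principal_character m n" for n
      by (metis complex_cnj_cnj complex_cnj_one complex_cnj_zero of_bool_def principal_character_def)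
    with \<chi>(2) show False by blast
  qed
  have "\<chi>' \<in> X" using cnj_in_dirichlet_characters[OF \<chi>(1)] by (simp add: X_def \<chi>'_def)
  have "L_one \<chi>' = 0" using L_one_cnj[OF nonprincipal_character_axioms] L0 by (simp add: \<chi>'_def)
  have Re_le: "(\<Sum>\<psi>\<in>X. Re (?c \<psi>)) \<le> -1"
  proof -
    have "(\<Sum>\<psi>\<in>X. Re (?c \<psi>)) = (\<Sum>\<psi>\<in>{principal_character m, \<chi>, \<chi>'}. Re (?c \<psi>))
        + (\<Sum>\<psi>\<in>X - {principal_character m, \<chi>, \<chi>'}. Re (?c \<psi>))"
      using fin \<chi> \<open>\<chi>' \<in> X\<close> principal_in_dirichlet_characters[OF m(2)]
      by (subst sum.subset_diff[of "{principal_character m, \<chi>, \<chi>'}" X]) (auto simp: X_def)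
    also have "(\<Sum>\<psi>\<in>X - {principal_character m, \<chi>, \<chi>'}. Re (?c \<psi>)) \<le> 0"
      by (intro sum_nonpos) (auto simp: mangoldt_sum_slope_def)
    also have "(\<Sum>\<psi>\<in>{principal_character m, \<chi>, \<chi>'}. Re (?c \<psi>)) = -1"
      using \<chi>(2) \<open>\<chi>' \<noteq> \<chi>\<close> \<open>\<chi>' \<noteq> principal_character m\<close> L0 \<open>L_one \<chi>' = 0\<close> by (auto simp: mangoldt_sum_slope_def)
    finally show ?thesis by simp
  qed
  obtain C where C: "norm (of_real (card X * (\<Sum>n\<in>{n\<in>{1..N}. [1 * n = 1] (mod m)}. mangoldt n / n))
                    - (\<Sum>\<psi>\<in>X. \<psi> 1 * ?c \<psi>) * of_real (ln (real N))) \<le> C" for N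
    using character_sum_asymptotics[OF m, of 1, folded X_def] by blast
  have "(\<Sum>\<psi>\<in>X. Re (?c \<psi>)) * ln (real N) \<ge> - C" for N
  proof -
    let ?A = "\<Sum>n\<in>{n\<in>{1..N}. [1 * n = 1] (mod m)}. mangoldt n / n :: real"
    have "(\<Sum>\<psi>\<in>X. \<psi> 1 * ?c \<psi>) = (\<Sum>\<psi>\<in>X. ?c \<psi>)"
      by (intro sum.cong refl) (use dirichlet_character.one[of m] in \<open>auto simp: X_def dirichlet_characters_def\<close>)
    hence "\<bar>Re (of_real (card X * ?A) - (\<Sum>\<psi>\<in>X. ?c \<psi>) * of_real (ln (real N)))\<bar> \<le> C"
      using C[of N] abs_Re_le_cmod order.trans by (metis (no_types, lifting))
    hence "card X * ?A - (\<Sum>\<psi>\<in>X. Re (?c \<psi>)) * ln (real N) \<le> C" by simp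
    moreover have "card X * ?A \<ge> 0" by (intro mult_nonneg_nonneg sum_nonneg) (auto simp: mangoldt_nonneg)
    ultimately show ?thesis by linarith
  qed
  hence "(\<Sum>\<psi>\<in>X. Re (?c \<psi>)) \<ge> 0" by (rule ln_multiple_bounded_below)
  with Re_le show False by simp
qed

text \<open>
  Only the principal character has a nonzero slope, so the sum of \<open>mangoldt n / n\<close> over the class of \<open>a\<close>
  grows like a positive multiple of \<open>ln N\<close>. If the class contained finitely many primes, that sum would be
  bounded.
\<close>
theorem dirichlet_primes_odd_modulus:
  fixes a m :: nat
  assumes m: "odd m" "m > 1" and a: "coprime a m"
  shows "infinite {p. prime p \<and> [p = a] (mod m)}"
proof
  let ?P = "{p. prime p \<and> [p = a] (mod m)}"
  assume fin: "finite ?P"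
  define X where "X = dirichlet_characters m"
  have finX: "finite X" unfolding X_def by (rule finite_dirichlet_characters[OF m(2)])
  have prin: "principal_character m \<in> X" using principal_in_dirichlet_characters[OF m(2)] by (simp add: X_def)
  obtain b where b: "[a * b = 1] (mod m)" using cong_solve_coprime_nat[OF a] by auto
  have cop_b: "coprime b m" using b by (metis cong_imp_coprime cong_sym coprime_1_left coprime_mult_left_iff)
  have "(\<Sum>\<chi>\<in>X. \<chi> b * mangoldt_sum_slope m \<chi>)
      = (\<Sum>\<chi>\<in>X. if \<chi> = principal_character m then 1 else (0::complex))"
    using L_one_nonzero[OF m] cop_b by (intro sum.cong) (auto simp: X_def principal_character_def mangoldt_sum_slope_def)
  also have "\<dots> = 1" using finX prin by simp
  finally have coeff: "(\<Sum>\<chi>\<in>X. \<chi> b * mangoldt_sum_slope m \<chi>) = 1" .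
  obtain C where C: "norm (of_real (card X * (\<Sum>n\<in>{n\<in>{1..N}. [b * n = 1] (mod m)}. mangoldt n / n))
                    - 1 * complex_of_real (ln (real N))) \<le> C" for N
    using character_sum_asymptotics[OF m, of b, folded X_def] unfolding coeff by blast
  define D where "D = 8 + (\<Sum>p\<in>?P. mangoldt p / p :: real)"
  have "-1 * ln (real N) \<ge> - (C + card X * D)" for N
  proof -
    let ?B = "{n\<in>{1..N}. [b * n = 1] (mod m)}"
    let ?A = "\<Sum>n\<in>?B. mangoldt n / n :: real"
    have "\<bar>card X * ?A - ln (real N)\<bar> \<le> C"
      using C[of N] unfolding mult_1 of_real_diff[symmetric] norm_of_real .
    moreover have "?A \<le> D"
    proof -
      have "?B \<subseteq> {n\<in>{1..N}. \<not> prime n} \<union> ?P"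
      proof
        fix n assume n: "n \<in> ?B"
        have "[n = a] (mod m)"
        proof -
          have "[b * n = 1] (mod m)" "[b * a = 1] (mod m)" using n b by (simp_all add: mult.commute)
          hence "[b * n = b * a] (mod m)" by (metis cong_sym cong_trans)
          thus ?thesis using cop_b by (simp add: cong_mult_lcancel_nat)
        qed
        thus "n \<in> {n\<in>{1..N}. \<not> prime n} \<union> ?P" using n by auto
      qed
      hence "?A \<le> (\<Sum>n\<in>{n\<in>{1..N}. \<not> prime n} \<union> ?P. mangoldt n / n)"
        using fin by (intro sum_mono2) (auto simp: mangoldt_nonneg)
      also have "\<dots> \<le> (\<Sum>n\<in>{n\<in>{1..N}. \<not> prime n}. mangoldt n / n) + (\<Sum>p\<in>?P. mangoldt p / p)"
        using fin by (intro sum_Un_nonneg_le) (auto simp: mangoldt_nonneg)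
      finally show ?thesis using sum_mangoldt_nonprime_bounded[of N] by (simp add: D_def)
    qed
    hence "card X * ?A \<le> card X * D" by (intro mult_left_mono) auto
    ultimately show ?thesis by linarith
  qed
  hence "(-1 :: real) \<ge> 0" by (rule ln_multiple_bounded_below)
  thus False by simp
qed

section \<open>The three families of orders\<close>

lemma not_primepow_exact_prime:
  fixes p r :: nat
  assumes "prime p" "p dvd r" "\<not> p\<^sup>2 dvd r" "r \<noteq> p"
  shows "\<not> primepow r"
proof
  assume "primepow r"
  then obtain q k where qk: "prime q" "k > 0" "r = q ^ k" by (auto simp: primepow_def)
  hence "p = q" using assms(1,2) by (metis prime_dvd_power primes_dvd_imp_eq)
  moreover have "k \<noteq> 1" using qk \<open>p = q\<close> assms(4) by auto
  hence "2 \<le> k" using qk(2) by simp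
  ultimately show False using assms(3) qk(3) by (simp add: le_imp_power_dvd)
qed

lemma primepow_minus_1_to_4_iff:
  "primepow_minus_1_to_4 n \<longleftrightarrow> primepow (n + 1) \<or> primepow (n + 2) \<or> primepow (n + 3) \<or> primepow (n + 4)"
proof -
  have "int n \<in> {int r - 1, int r - 2, int r - 3, int r - 4} \<longleftrightarrow> r \<in> {n + 1, n + 2, n + 3, n + 4}" for r
    by auto
  thus ?thesis by (auto simp: primepow_minus_1_to_4_def)
qed

lemma cong_power_period:
  fixes a :: nat
  assumes "[a ^ s = 1] (mod M)" "s dvd t"
  shows "[a ^ (r + t) = a ^ r] (mod M)"
proof -
  obtain j where t: "t = s * j" using assms(2) by blast
  have "[(a ^ s) ^ j = 1 ^ j] (mod M)" using assms(1) by (rule cong_pow)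
  hence "[a ^ r * (a ^ s) ^ j = a ^ r * 1] (mod M)" by (intro cong_mult) auto
  thus ?thesis by (simp add: t power_add power_mult)
qed

lemma cong_dvd_add_iff:
  fixes x y :: nat
  assumes "[x = y] (mod M)" "d dvd M"
  shows "d dvd x + k \<longleftrightarrow> d dvd y + k"
  using assms by (meson cong_add_rcancel_nat cong_dvd_iff cong_dvd_modulus_nat)

lemma infinite_if_family:
  fixes f :: "nat \<Rightarrow> nat"
  assumes "inj f" "\<And>j. f j \<in> S"
  shows "infinite S"
  using assms by (meson finite_subset image_subsetI range_inj_infinite)

text \<open>
  The exponent \<open>390\<close> is a common multiple of the orders \<open>5\<close>, \<open>39\<close>, \<open>2\<close> of \<open>3\<close> modulo \<open>11\<^sup>2\<close>, \<open>13\<^sup>2\<close>, \<open>2\<^sup>2\<close>.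
  Hence \<open>q = 9\<close> holds modulo these squares, and \<open>q + 2\<close>, \<open>q + 4\<close>, \<open>q + 5\<close> are exactly divisible by
  \<open>11\<close>, \<open>13\<close>, \<open>2\<close> as at \<open>q = 9\<close>, while \<open>q + 3\<close> is divisible by \<open>2\<close> and \<open>3\<close>. The exponent \<open>2\<close> itself is
  left out, since \<open>11\<close> and \<open>13\<close> are prime.
\<close>
lemma infinite_singer_orders:
  "infinite {n \<in> singer_orders. composite n \<and> \<not> primepow_minus_1_to_4 n}"
proof (rule infinite_if_family)
  define q :: "nat \<Rightarrow> nat" where "q = (\<lambda>j. 3 ^ (2 + 390 * Suc j))"
  show "inj (\<lambda>j. q j + 1)" by (auto simp: inj_on_def q_def)
  fix j
  have q_gt: "q j > 11"
  proof -
    have "(11 :: nat) < 3 ^ 3" by simp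
    also have "\<dots> \<le> q j" unfolding q_def by (intro power_increasing) auto
    finally show ?thesis .
  qed
  have "[q j = 3 ^ 2] (mod 121)" unfolding q_def
    by (rule cong_power_period[of 3 5]) (simp_all add: cong_def)
  note mod_121 = cong_dvd_add_iff[OF this]
  have "[q j = 3 ^ 2] (mod 169)" unfolding q_def
    by (rule cong_power_period[of 3 39]) (simp_all add: cong_def)
  note mod_169 = cong_dvd_add_iff[OF this]
  have "[q j = 3 ^ 2] (mod 4)" unfolding q_def
    by (rule cong_power_period[of 3 2]) (simp_all add: cong_def)
  note mod_4 = cong_dvd_add_iff[OF this]
  have "primepow (q j)" using primepowI[of 3 "2 + 390 * Suc j"] by (simp add: q_def)
  moreover have odd: "odd (q j)" by (simp add: q_def)
  ultimately have "q j + 1 \<in> singer_orders" by (auto simp: singer_orders_def)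
  moreover have "composite (q j + 1)"
    using odd q_gt prime_odd_nat[of "q j + 1"] by (auto simp: composite_def)
  moreover have "\<not> primepow (q j + 1 + 1)"
    by (rule not_primepow_exact_prime[of 11]) (use q_gt mod_121[of 11 2] mod_121[of "11\<^sup>2" 2] in auto)
  moreover have "\<not> primepow (q j + 1 + 2)"
  proof (rule not_primepowI[of 2 3])
    have "3 dvd q j" unfolding q_def by (rule dvd_power) simp
    thus "3 dvd q j + 1 + 2" by presburger
  qed (use odd in auto)
  moreover have "\<not> primepow (q j + 1 + 3)"
    by (rule not_primepow_exact_prime[of 13]) (use q_gt mod_169[of 13 4] mod_169[of "13\<^sup>2" 4] in \<open>auto simp: add.commute\<close>)
  moreover have "\<not> primepow (q j + 1 + 4)"
    by (rule not_primepow_exact_prime[of 2]) (use q_gt mod_4[of 2 5] mod_4[of "2\<^sup>2" 5] in \<open>auto simp: add.commute\<close>)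
  ultimately show "q j + 1 \<in> {n \<in> singer_orders. composite n \<and> \<not> primepow_minus_1_to_4 n}"
    by (simp add: primepow_minus_1_to_4_iff)
qed

text \<open>
  At \<open>d = 9\<close>, \<open>n = 9841\<close> is divisible by \<open>13\<close>, \<open>n + 1\<close> by \<open>2\<close> and \<open>7\<close>, \<open>n + 3\<close> by \<open>2\<close> and \<open>23\<close>,
  \<open>n + 4\<close> by \<open>5\<close> and \<open>11\<close>, and \<open>n - 1\<close> by \<open>5\<close>. The period \<open>660\<close> is a multiple of the orders of
  \<open>3\<close> modulo \<open>8\<close>, \<open>5\<close>, \<open>7\<close>, \<open>11\<close>, \<open>13\<close>, \<open>23\<close>, so all this persists; the even modulus has to be
  twice as fine for \<open>3 ^ d = 2 * n + 1\<close> as for \<open>n\<close>. From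
  \<open>9 dvd 3 ^ d\<close> it follows that \<open>n = 4\<close> modulo \<open>9\<close>, so \<open>3\<close> divides \<open>n - 1\<close> and exactly divides \<open>n + 2\<close>.
\<close>
lemma infinite_ternary_binomial_orders:
  "infinite {n \<in> ternary_binomial_orders. composite n \<and> \<not> primepow_minus_1_to_4 n \<and> \<not> primepow_plus_1 n}"
proof (rule infinite_if_family)
  define d :: "nat \<Rightarrow> nat" where "d = (\<lambda>j. 9 + 660 * j)"
  define f :: "nat \<Rightarrow> nat" where "f = (\<lambda>j. (3 ^ d j - 1) div 2)"
  have f_eq: "2 * f j + 1 = 3 ^ d j" for j
  proof -
    have "odd ((3 :: nat) ^ d j)" by simp
    then obtain k where "(3 :: nat) ^ d j = 2 * k + 1" by (rule oddE)
    thus ?thesis by (simp add: f_def)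
  qed
  show "inj f"
  proof (rule injI)
    fix i j assume "f i = f j"
    hence "(3 :: nat) ^ d i = 3 ^ d j" using f_eq by metis
    thus "i = j" by (simp add: d_def)
  qed
  fix j
  have f_cong: "[2 * f j = 2 * 9841] (mod M)" if "[3 ^ s = 1] (mod M)" "s dvd 660" for s M :: nat
  proof -
    have "[2 * f j + 1 = 3 ^ 9] (mod M)"
      unfolding f_eq d_def using that by (intro cong_power_period[of 3 s]) auto
    moreover have "(3 :: nat) ^ 9 = 2 * 9841 + 1" by simp
    ultimately have "[2 * f j + 1 = 2 * 9841 + 1] (mod M)" by metis
    thus ?thesis by (rule cong_add_rcancel_nat[THEN iffD1])
  qed
  \<comment> \<open>\<open>3 ^ 12\<close> is \<open>1\<close> modulo \<open>3640 = 8 * 5 * 7 * 13\<close>, and \<open>3 ^ 55\<close> is \<open>1\<close> modulo \<open>253 = 11 * 23\<close>.\<close>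
  have "[2 * f j = 2 * 9841] (mod 2 * 1820)"
    by (rule f_cong[of 12]) (simp_all add: cong_def)
  hence "[f j = 9841] (mod 1820)"
    by (simp only: cong_def mult_mod_right[symmetric] mult_cancel_left) simp
  note mod_1820 = cong_dvd_add_iff[OF this]
  have "[2 * f j = 2 * 9841] (mod 253)"
    by (rule f_cong[of 55]) (simp_all add: cong_def)
  hence "[f j = 9841] (mod 253)"
    by (subst (asm) cong_mult_lcancel_nat) simp_all
  note mod_253 = cong_dvd_add_iff[OF this]
  have "(3::nat) ^ d j = 9 * 3 ^ (7 + 660 * j)" by (simp add: d_def power_add)
  hence "9 dvd 2 * f j + 1" unfolding f_eq by simp
  hence mod9: "f j mod 9 = 4" by presburger
  have f_ge: "f j \<ge> 9841"
  proof -
    have "(3 :: nat) ^ 9 \<le> 3 ^ d j" by (intro power_increasing) (auto simp: d_def)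
    thus ?thesis using f_eq[of j] by simp
  qed
  have "f j \<in> ternary_binomial_orders" by (auto simp: ternary_binomial_orders_def f_def d_def)
  moreover have "composite (f j)"
  proof -
    have "13 dvd f j" using mod_1820[of 13 0] by simp
    hence "\<not> prime (f j)" using f_ge primes_dvd_imp_eq[of 13 "f j"] by auto
    thus ?thesis using f_ge by (simp add: composite_def)
  qed
  moreover have "\<not> primepow (f j + 1)"
    by (rule not_primepowI[of 2 7]) (use mod_1820[of 2 1] mod_1820[of 7 1] in auto)
  moreover have "\<not> primepow (f j + 2)"
  proof (rule not_primepow_exact_prime[of 3])
    show "3 dvd f j + 2" using mod9 by presburger
    have "\<not> 9 dvd f j + 2" using mod9 by presburger
    thus "\<not> 3\<^sup>2 dvd f j + 2" by simp
  qed (use f_ge in auto)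
  moreover have "\<not> primepow (f j + 3)"
    by (rule not_primepowI[of 2 23]) (use mod_1820[of 2 3] mod_253[of 23 3] in auto)
  moreover have "\<not> primepow (f j + 4)"
    by (rule not_primepowI[of 5 11]) (use mod_1820[of 5 4] mod_253[of 11 4] in auto)
  moreover have "\<not> primepow_plus_1 (f j)"
  proof
    assume "primepow_plus_1 (f j)"
    then obtain r where r: "primepow r" "f j = r + 1" by (auto simp: primepow_plus_1_def)
    have "3 dvd r" using mod9 r(2) by presburger
    moreover have "5 dvd r" using mod_1820[of 5 4] r(2) by (simp add: dvd_add_left_iff)
    ultimately show False using not_primepowI[of 3 5 r] r(1) by auto
  qed
  ultimately show "f j \<in> {n \<in> ternary_binomial_orders. composite n \<and> \<not> primepow_minus_1_to_4 n \<and> \<not> primepow_plus_1 n}"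
    by (simp add: primepow_minus_1_to_4_iff)
qed

text \<open>
  Modulo \<open>105\<^sup>2 = 11025\<close> the prime \<open>p\<close> looks like \<open>2\<close>, so \<open>2p - 1\<close>, \<open>2p + 1\<close>, \<open>2p + 3\<close> are exactly divisible by
  \<open>3\<close>, \<open>5\<close>, \<open>7\<close>. The condition \<open>p = 5\<close> modulo \<open>6\<close> follows, since \<open>p\<close> is odd and is \<open>2\<close> modulo \<open>3\<close>; it makes
  \<open>2p + 2\<close> divisible by \<open>6\<close>.
\<close>
lemma infinite_completed_reciprocal_orders:
  "infinite {n \<in> completed_reciprocal_orders. composite n \<and> \<not> primepow_minus_1_to_4 n \<and> \<not> primepow_plus_1 n}"
    (is "infinite ?N")
proof -
  define P where "P = {p :: nat. prime p \<and> [p = 2] (mod 11025)} - {2}"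
  have "infinite P"
    unfolding P_def by (intro Diff_infinite_finite dirichlet_primes_odd_modulus) auto
  moreover have "inj_on (\<lambda>p. 2 * p) P" by (simp add: inj_on_def)
  ultimately have "infinite ((\<lambda>p. 2 * p) ` P)" by (simp add: finite_image_iff)
  moreover have "(\<lambda>p. 2 * p) ` P \<subseteq> ?N"
  proof
    fix n assume "n \<in> (\<lambda>p. 2 * p) ` P"
    then obtain p where p: "prime p" "[p = 2] (mod 11025)" "p \<noteq> 2" and n: "n = 2 * p" by (auto simp: P_def)
    have p_gt: "p > 5"
    proof (rule ccontr)
      assume "\<not> p > 5"
      hence "p mod 11025 = p" by simp
      with p(2,3) show False by (simp add: cong_def)
    qed
    have odd: "odd p" using p_gt prime_odd_nat[OF p(1)] by simp
    have "[p = 2] (mod 3)" using p(2) by (rule cong_dvd_modulus_nat) simp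
    hence "p mod 3 = 2" by (simp add: cong_def)
    with odd have mod6: "p mod 6 = 5" by presburger
    have "[n = 2 * 2] (mod 11025)" unfolding n using p(2) by (intro cong_mult) auto
    note dvd_iff = cong_dvd_add_iff[OF this]
    have "n \<in> completed_reciprocal_orders"
      using p(1) p_gt mod6 by (auto simp: completed_reciprocal_orders_def n cong_def)
    moreover have "composite n" using p_gt prime_product[of 2 p] by (auto simp: composite_def n)
    moreover have "\<not> primepow (n + 1)"
      by (rule not_primepow_exact_prime[of 5]) (use p_gt dvd_iff[of 5 1] dvd_iff[of "5\<^sup>2" 1] in \<open>auto simp: n\<close>)
    moreover have "\<not> primepow (n + 2)"
    proof (rule not_primepowI[of 2 3])
      show "3 dvd n + 2" using mod6 unfolding n by presburger
    qed (auto simp: n)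
    moreover have "\<not> primepow (n + 3)"
      by (rule not_primepow_exact_prime[of 7]) (use p_gt dvd_iff[of 7 3] dvd_iff[of "7\<^sup>2" 3] in \<open>auto simp: n\<close>)
    moreover have "\<not> primepow (n + 4)"
    proof (rule not_primepow_exact_prime[of 2])
      show "2 dvd n + 4" by (simp add: n)
      have "\<not> 4 dvd n + 4" using odd unfolding n by presburger
      thus "\<not> 2\<^sup>2 dvd n + 4" by simp
    qed (use p_gt in auto)
    moreover have "\<not> primepow_plus_1 n"
    proof
      assume "primepow_plus_1 n"
      then obtain r where r: "primepow r" "n = r + 1" by (auto simp: primepow_plus_1_def)
      have "[r + 1 = 3 + 1] (mod 11025)" using \<open>[n = 2 * 2] (mod 11025)\<close> r(2) by simp
      hence "[r = 3] (mod 11025)" by (rule cong_add_rcancel_nat[THEN iffD1])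
      from cong_dvd_add_iff[OF this, of 3 0] cong_dvd_add_iff[OF this, of "3\<^sup>2" 0]
      have "3 dvd r" "\<not> 3\<^sup>2 dvd r" by simp_all
      moreover have "r \<noteq> 3" using r(2) p_gt n by simp
      ultimately show False using not_primepow_exact_prime[of 3 r] r(1) by simp
    qed
    ultimately show "n \<in> ?N" by (simp add: primepow_minus_1_to_4_iff)
  qed
  ultimately show ?thesis by (rule infinite_super[rotated])
qed

theorem corollary4:
  shows "(\<forall>N \<in> {singer_orders, ternary_binomial_orders, completed_reciprocal_orders}.
            infinite {n \<in> N. composite n \<and> \<not> primepow_minus_1_to_4 n})
       \<and> (\<forall>N \<in> {ternary_binomial_orders, completed_reciprocal_orders}.
            infinite {n \<in> N. \<not> primepow_plus_1 n})
       \<and> {q + 1 | q::nat. prime q \<and> [q = 269363] (mod 471240)} \<subseteq> singer_orders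
       \<and> {q + 1 | q::nat. prime q \<and> [q = 269363] (mod 471240)} \<inter> {2 * p | p::nat. prime p} = {}"
proof (intro conjI)
  have "infinite {n \<in> ternary_binomial_orders. composite n \<and> \<not> primepow_minus_1_to_4 n}"
    "infinite {n \<in> completed_reciprocal_orders. composite n \<and> \<not> primepow_minus_1_to_4 n}"
    by (rule infinite_super[OF _ infinite_ternary_binomial_orders]
             infinite_super[OF _ infinite_completed_reciprocal_orders]; blast)+
  thus "\<forall>N \<in> {singer_orders, ternary_binomial_orders, completed_reciprocal_orders}.
          infinite {n \<in> N. composite n \<and> \<not> primepow_minus_1_to_4 n}"
    using infinite_singer_orders by simp
  have "infinite {n \<in> ternary_binomial_orders. \<not> primepow_plus_1 n}"
    "infinite {n \<in> completed_reciprocal_orders. \<not> primepow_plus_1 n}"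
    by (rule infinite_super[OF _ infinite_ternary_binomial_orders]
             infinite_super[OF _ infinite_completed_reciprocal_orders]; blast)+
  thus "\<forall>N \<in> {ternary_binomial_orders, completed_reciprocal_orders}. infinite {n \<in> N. \<not> primepow_plus_1 n}"
    by simp
  have mod4: "q mod 4 = 3" if "[q = 269363] (mod 471240)" for q :: nat
  proof -
    have "[q = 269363] (mod 4)" using that by (rule cong_dvd_modulus_nat) simp
    thus ?thesis by (simp add: cong_def)
  qed
  show "{q + 1 | q::nat. prime q \<and> [q = 269363] (mod 471240)} \<subseteq> singer_orders"
  proof safe
    fix q :: nat assume q: "prime q" "[q = 269363] (mod 471240)"
    have "odd q" using mod4[OF q(2)] by presburger
    thus "q + 1 \<in> singer_orders" using q(1) by (auto simp: singer_orders_def)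
  qed
  show "{q + 1 | q::nat. prime q \<and> [q = 269363] (mod 471240)} \<inter> {2 * p | p::nat. prime p} = {}"
  proof safe
    fix q p :: nat assume q: "[q = 269363] (mod 471240)" and p: "prime p" "q + 1 = 2 * p"
    have "even p" using mod4[OF q] p(2) by presburger
    hence "p = 2" using p(1) by (metis primes_dvd_imp_eq two_is_prime_nat)
    hence "q = 3" using p(2) by simp
    thus "q + 1 \<in> {}" using q by (simp add: cong_def)
  qed
qed

end
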